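(* Let $0<p<1/2$, and set $\alpha=\frac{p+(1-p)\log(1-p)}{2(1-p)p^2}$ and $c=4p(1-p)$, and assume $c<1/2$. Then the output $SOL$ of the KickNext algorithm with parameter $p$ satisfies $$\mathbb E[w(SOL)]\ge p\left(1-\frac{2\alpha c}{(1-c)^2}\right)w(\mathrm{OPT}).$$
   Context: Let $U$ be a finite ground set, $n=|U|$, with weight function $w:U\to\mathbb{R}_{\ge0}$ taking pairwise distinct values; for $X\subseteq U$, $w(X)=\sum_{x\in X}w(x)$. Let $\mathcal F$ be a laminar family of subsets of $U$ (for any $A,B\in\mathcal F$: $A\subseteq B$, $B\subseteq A$, or $A\cap B=\emptyset$) with $U\in\mathcal F$; each $A\in\mathcal F$ has a positive integer capacity $\mu(A)$, with $\mu(A)<\mu(B)$ whenever $A\subsetneq B$. A set $X\subseteq U$ is independent iff $|X\cap A|\le\mu(A)$ for all $A\in\mathcal F$. For $i\in U$, $M(i)$ denotes the minimal member of $\mathcal F$ containing $i$. For $A\subseteq B$ in $\mathcal F$, $\mathrm{Chain}[A,B]$ is the sequence of all $B'\in\mathcal F$ with $A\subseteq B'\subseteq B$, ordered by inclusion from $A$ up to $B$. For $V\subseteq U$ and $B\in\mathcal F$, $\mathrm{OPT}_V(B)$ is the maximum-weight independent subset of $V\cap B$; $\mathrm{OPT}=\mathrm{OPT}_U(U)$. Random model: a uniformly random ordering $\pi$ of $U$ is drawn and, independently, $t\sim\mathrm{Binom}(n,1-p)$; $S=\{\pi(1),\dots,\pi(t)\}$ and $T=U\setminus S$. KickNext algorithm: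 for each $B\in\mathcal F$ initialize $R(B)=\mathrm{OPT}_S(B)$ and $SOL(B)=\emptyset$. Process the elements $i\in T$ in the order $\pi$; for each such $i$, visit the sets $B\in\mathrm{Chain}[M(i),U]$ in order from $M(i)$ upward; at each visited $B$: if $R(B)$ contains an element of weight less than $w(i)$, add $i$ to $SOL(B)$, remove from $R(B)$ the element of largest weight among those of weight less than $w(i)$, and continue to the next set in the chain; otherwise stop processing $i$. The output is $SOL=SOL(U)$. Standing convention of the paper: by padding $U$ with dummy elements of infinitesimal weight, one assumes $|\mathrm{OPT}_S(B)|=\mu(B)$ for every $B\in\mathcal F$. *)

theory Defs
  imports "HOL-Probability.Probability" "HOL-Combinatorics.Multiset_Permutations"
begin

definition wsum :: "('a \<Rightarrow> real) \<Rightarrow> 'a set \<Rightarrow> real" where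
  "wsum w X = (\<Sum>x\<in>X. w x)"

definition laminar :: "'a set set \<Rightarrow> bool" where
  "laminar F \<longleftrightarrow> (\<forall>A\<in>F. \<forall>B\<in>F. A \<subseteq> B \<or> B \<subseteq> A \<or> A \<inter> B = {})"

definition indep :: "'a set set \<Rightarrow> ('a set \<Rightarrow> nat) \<Rightarrow> 'a set \<Rightarrow> bool" where
  "indep F \<mu> X \<longleftrightarrow> (\<forall>A\<in>F. card (X \<inter> A) \<le> \<mu> A)"

text \<open>OPT_V(B): the maximum-weight independent subset of V \<inter> B (ties caused by a
  possible zero-weight element are broken towards larger cardinality, i.e. the
  maximum-weight basis).\<close>
definition OPT :: "'a set set \<Rightarrow> ('a set \<Rightarrow> nat) \<Rightarrow> ('a \<Rightarrow> real) \<Rightarrow> 'a set \<Rightarrow> 'a set \<Rightarrow> 'a set" where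
  "OPT F \<mu> w V B = (THE X. X \<subseteq> V \<inter> B \<and> indep F \<mu> X \<and>
      (\<forall>Y. Y \<subseteq> V \<inter> B \<and> indep F \<mu> Y \<longrightarrow>
         wsum w Y < wsum w X \<or> (wsum w Y = wsum w X \<and> card Y \<le> card X)))"

definition minset :: "'a set set \<Rightarrow> 'a \<Rightarrow> 'a set" where
  "minset F i = (THE A. A \<in> F \<and> i \<in> A \<and> (\<forall>A'\<in>F. i \<in> A' \<longrightarrow> A \<subseteq> A'))"

definition chain_list :: "'a set set \<Rightarrow> 'a set \<Rightarrow> 'a set \<Rightarrow> 'a set list" where
  "chain_list F A B = (SOME xs. set xs = {B'\<in>F. A \<subseteq> B' \<and> B' \<subseteq> B} \<and> sorted_wrt (\<subset>) xs)"

text \<open>The state R(B) of a set B is a pair (real elements, number of dummy elements).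
  Dummy elements (from the padding convention) have infinitesimal weight, i.e. weight
  below every real weight.  A kick at B by element i: if R(B) contains an element of
  weight less than w(i), remove the heaviest such one and return the new state.\<close>
definition kick :: "('a \<Rightarrow> real) \<Rightarrow> ('a set \<Rightarrow> 'a set \<times> nat) \<Rightarrow> 'a set \<Rightarrow> 'a
                     \<Rightarrow> ('a set \<Rightarrow> 'a set \<times> nat) option" where
  "kick w R B i =
     (let (X, d) = R B in
      if (\<exists>x\<in>X. w x < w i)
      then Some (R(B := (X - {ARG_MAX w x. x \<in> X \<and> w x < w i}, d)))
      else if d > 0 then Some (R(B := (X, d - 1)))
      else None)"

fun process_chain :: "('a \<Rightarrow> real) \<Rightarrow> 'a \<Rightarrow> 'a set list \<Rightarrow>
     ('a set \<Rightarrow> 'a set \<times> nat) \<times> ('a set \<Rightarrow> 'a set) \<Rightarrow>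
     ('a set \<Rightarrow> 'a set \<times> nat) \<times> ('a set \<Rightarrow> 'a set)" where
  "process_chain w i [] st = st"
| "process_chain w i (B # Bs) (R, SOL) =
     (case kick w R B i of
        None \<Rightarrow> (R, SOL)
      | Some R' \<Rightarrow> process_chain w i Bs (R', SOL(B := insert i (SOL B))))"

definition kicknext :: "'a set \<Rightarrow> 'a set set \<Rightarrow> ('a set \<Rightarrow> nat) \<Rightarrow> ('a \<Rightarrow> real)
                         \<Rightarrow> 'a list \<Rightarrow> nat \<Rightarrow> 'a set" where
  "kicknext U F \<mu> w xs t =
     (let S = set (take t xs);
          R0 = (\<lambda>B. (OPT F \<mu> w S B, \<mu> B - card (OPT F \<mu> w S B)));
          final = fold (\<lambda>i st. process_chain w i (chain_list F (minset F i) U) st)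
                       (drop t xs) (R0, (\<lambda>_. {}))
      in snd final U)"

end

(*
  Only elements x of O = OPT are counted.  If x arrives in T and is not selected, it is stopped
  at some B containing x: every slot of R(B) below x has been used.  Kicking the next lighter
  element is parking into the next free slot, so for some m at least m candidates of B that
  arrived before x lie among the last m slots of B.  Reading the elements by decreasing weight, the
  candidates of B are coin tosses (heads: sampled and hence in OPT_S(B), tails: an early element
  of T), and a potential function bounds the probability of m tails before the last m heads by
  2 q (4 q (1 - q))^(m - 1), where q = p * tau / (1 - p + p * tau) and tau is the (uniform)
  arrival time of x within T.  Since x is in O, only the m with mu(B) - h <= m <= mu(B) matter,
  where h counts the elements of O in B heavier than x.  Averaging over tau and summing over m
  bounds the failure probability at B by p * alpha * c^(mu(B) - h) / (1 - c).  Finally, laminarity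
  together with the strict growth of mu gives that the sum over x in O and B containing x of
  w(x) c^(mu(B) - h - 1) is at most 2 w(O) / (1 - c).
*)
theory Submission
  imports Defs
begin

text \<open>For fixed \<open>t\<close> and a fixed position of x in T, the sample and the early
  elements have prescribed sizes, so the labels of the other elements are dependent. A binomial
  \<open>t\<close> and a uniform time \<tau> make them independent: sampled, early, late with
  weights 1 - p, p * \<tau>, p * (1 - \<tau>); q is the probability of early given not late. A
  second dependency remains: whether an element is a candidate of B depends on other labels, but
  only on those of heavier elements, which a supermartingale tolerates. As q \<le> p < 1/2, the base
  4 q (1 - q) is at most its value c at p; only the leading q is averaged over \<tau>. Its mean J =
  (p + (1 - p) log(1 - p)) / p is the origin of the logarithm, and \<alpha> is 2 J / c. One factor 1
  / (1 - c) is the geometric series in m, the other comes from the laminar charging.\<close>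

section \<open>Charging in laminar families\<close>

text \<open>Abel summation: a nonnegative \<open>w\<close> is a nonnegative combination of
  indicators of its superlevel sets, so it suffices to control those sets. The induction peels off
  the lowest level.\<close>

lemma abel_sum_nonneg:
  fixes w e :: "'a \<Rightarrow> real"
  assumes "finite X" "\<And>x. x \<in> X \<Longrightarrow> 0 \<le> w x"
    and "\<And>\<theta>. 0 \<le> (\<Sum>x | x \<in> X \<and> \<theta> \<le> w x. e x)"
  shows "0 \<le> (\<Sum>x\<in>X. w x * e x)"
  using assms
proof (induction "card X" arbitrary: X w rule: less_induct)
  case less
  show ?case
  proof (cases "X = {}")
    case False
    have "Min (w ` X) \<in> w ` X" using less.prems(1) False by (intro Min_in) auto
    then obtain z where z: "z \<in> X" "w z = Min (w ` X)" by auto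
    then have min: "w z \<le> w x" if "x \<in> X" for x using less.prems(1) that by simp
    define w' where "w' = (\<lambda>x. w x - w z)"
    have "{x\<in>X. w z \<le> w x} = X" using min by auto
    then have tot: "0 \<le> (\<Sum>x\<in>X. e x)" using less.prems(3)[of "w z"] by simp
    have "0 \<le> (\<Sum>x\<in>{x\<in>X. 0 < w' x}. w' x * e x)"
    proof (rule less.hyps)
      show "card {x\<in>X. 0 < w' x} < card X"
      proof (rule psubset_card_mono[OF less.prems(1)])
        have "z \<notin> {x\<in>X. 0 < w' x}" unfolding w'_def by simp
        then show "{x\<in>X. 0 < w' x} \<subset> X" using z(1) by auto
      qed
      show "finite {x\<in>X. 0 < w' x}" using less.prems(1) by simp
      show "0 \<le> w' x" if "x \<in> {x\<in>X. 0 < w' x}" for x using that by simp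
      fix \<theta> :: real
      show "0 \<le> (\<Sum>x | x \<in> {x\<in>X. 0 < w' x} \<and> \<theta> \<le> w' x. e x)"
      proof (cases "{x\<in>X. 0 < w' x \<and> \<theta> \<le> w' x} = {}")
        case True
        then have "{x. x \<in> {x\<in>X. 0 < w' x} \<and> \<theta> \<le> w' x} = {}" by auto
        then show ?thesis by (simp only: sum.empty order_refl)
      next
        case nonempty: False
        let ?Y = "{x\<in>X. 0 < w' x \<and> \<theta> \<le> w' x}"
        \<comment> \<open>\<open>\<theta>\<close> may lie in a gap between values or below 0;
          replacing it by the weight of the lightest element that passes gives a superlevel set of
          the original \<open>w\<close>.\<close>
        have finY: "finite ?Y" using less.prems(1) by simp
        have "Min (w ` ?Y) \<in> w ` ?Y" using finY nonempty by (intro Min_in) auto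
        then obtain y where y: "y \<in> ?Y" "w y = Min (w ` ?Y)" by auto
        have "w y \<le> w x" if "x \<in> ?Y" for x using y(2) finY that by simp
        then have "{x. x \<in> {x\<in>X. 0 < w' x} \<and> \<theta> \<le> w' x} = {x. x \<in> X \<and> w y \<le> w x}"
          using y(1) unfolding w'_def by fastforce
        then show ?thesis using less.prems(3)[of "w y"] by simp
      qed
    qed
    also have "(\<Sum>x\<in>{x\<in>X. 0 < w' x}. w' x * e x) = (\<Sum>x\<in>X. w' x * e x)"
      using less.prems(1) min unfolding w'_def by (intro sum.mono_neutral_left) force+
    finally have "0 \<le> (\<Sum>x\<in>X. w' x * e x)" .
    moreover have "(\<Sum>x\<in>X. w x * e x) = (\<Sum>x\<in>X. w' x * e x) + w z * (\<Sum>x\<in>X. e x)"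
      unfolding w'_def by (simp add: algebra_simps sum_subtractf sum_distrib_left)
    ultimately show ?thesis using tot less.prems(2)[OF z(1)] by simp
  qed simp
qed

text \<open>The extra summand on the left makes the induction work: as a function of
  \<open>card X\<close> it is subadditive (for a fixed \<open>M \<ge> card X\<close>), and the drop
  caused by raising \<open>M\<close> from \<open>\<mu> B\<close> to \<open>\<mu> B + 1\<close> is exactly the
  term contributed by \<open>B\<close>.\<close>

lemma laminar_power_sum_aux:
  fixes c :: real and \<mu> :: "'a set \<Rightarrow> nat"
  assumes c: "0 < c" "c < 1"
    and "finite F" "laminar F"
    and "\<And>A B. A \<in> F \<Longrightarrow> B \<in> F \<Longrightarrow> A \<subset> B \<Longrightarrow> \<mu> A < \<mu> B"
    and "finite X" "\<And>A. A \<in> F \<Longrightarrow> card (X \<inter> A) \<le> \<mu> A"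
    and "\<And>A. A \<in> F \<Longrightarrow> \<mu> A < M" "card X \<le> M"
  shows "(\<Sum>A\<in>F. (1 - c) * c ^ (\<mu> A - card (X \<inter> A)) * (1 - c ^ card (X \<inter> A)))
           + (1 - c ^ card X) * (1 + c ^ (M - card X)) \<le> 2 * (1 - c) * card X"
  using assms(3-)
proof (induction "card F" arbitrary: F X M rule: less_induct)
  case less
  define h where "h = (\<lambda>M m::nat. (1 - c ^ m) * (1 + c ^ (M - m)))"
  define f where "f = (\<lambda>X A. (1 - c) * c ^ (\<mu> A - card (X \<inter> A)) * (1 - c ^ card (X \<inter> A)))"
  have pow_le: "c ^ m \<le> 1" for m using c by (simp add: power_le_one)
  have subadd: "h M (m + n) \<le> h M m + h M n" if mn: "m + n \<le> M" for M m n
  proof -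
    obtain d where d: "M = m + n + d" using le_Suc_ex[OF mn] by auto
    have "h M m + h M n - h M (m + n) = (1 - c ^ m) * (1 - c ^ n) * (1 - c ^ d)"
    proof -
      have "M - m = n + d" "M - n = m + d" "M - (m + n) = d" using d by auto
      then show ?thesis unfolding h_def by (simp add: algebra_simps power_add)
    qed
    also have "\<dots> \<ge> 0" using pow_le by simp
    finally show ?thesis by simp
  qed
  show ?case
  proof (cases "F = {}")
    case True
    have "h M m \<le> 2 * (1 - c) * m" if "m \<le> M" for m
      using that
    proof (induction m)
      case (Suc m)
      have "h M (m + 1) \<le> h M m + h M 1" using Suc.prems by (intro subadd) simp
      \<comment> \<open>A single element costs (1 - c) * (1 + c ^ (M - 1)); bounding the power by 1
        produces the 2.\<close>
      also have "h M 1 \<le> 2 * (1 - c)"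
        unfolding h_def using c pow_le[of "M - 1"] mult_left_mono[of "1 + c ^ (M - 1)" 2 "1 - c"] by simp
      also have "h M m \<le> 2 * (1 - c) * m" using Suc by simp
      finally show ?case by (simp add: algebra_simps)
    qed (simp add: h_def)
    then show ?thesis using True less.prems(7) unfolding h_def by simp
  next
    case False
    obtain B where B: "B \<in> F" "\<forall>A\<in>F. B \<subseteq> A \<longrightarrow> B = A"
      using finite_has_maximal[OF less.prems(1) False] by blast
    \<comment> \<open>The sets strictly inside a maximal \<open>B\<close> are handled with
      \<open>\<mu> B\<close> in place of \<open>M\<close>; the sets of \<open>F2\<close> are
      disjoint from \<open>B\<close> and keep \<open>M\<close>.\<close>
    define F1 where "F1 = {A\<in>F. A \<subset> B}"
    define F2 where "F2 = {A\<in>F. \<not> A \<subseteq> B}"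
    have sub: "F1 \<subseteq> F" "F2 \<subseteq> F" "B \<notin> F1" "B \<notin> F2" unfolding F1_def F2_def by auto
    have F_eq: "F = insert B (F1 \<union> F2)" "F1 \<inter> F2 = {}" using B unfolding F1_def F2_def by auto
    have F2_disj: "A \<inter> B = {}" if "A \<in> F2" for A
      using that B less.prems(2) unfolding F2_def laminar_def by blast
    have finF: "finite F1" "finite F2" using sub less.prems(1) finite_subset by auto
    have cards: "card F1 < card F" "card F2 < card F"
      using sub B(1) less.prems(1) by (auto intro!: psubset_card_mono)
    have laminar_sub: "laminar G" if "G \<subseteq> F" for G
      using that less.prems(2) unfolding laminar_def by blast
    define X1 where "X1 = X \<inter> B"
    define X2 where "X2 = X - B"
    have finX: "finite X1" "finite X2" using less.prems(4) unfolding X1_def X2_def by auto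
    have cX: "card X = card X1 + card X2"
      unfolding X1_def X2_def using card_Int_Diff[OF less.prems(4)] .
    have X1: "X1 \<inter> A = X \<inter> A" if "A \<in> F1" for A using that unfolding F1_def X1_def by auto
    have X2: "X2 \<inter> A = X \<inter> A" if "A \<in> F2" for A using F2_disj[OF that] unfolding X2_def by auto
    have m1: "card X1 \<le> \<mu> B" using less.prems(5)[OF B(1)] unfolding X1_def .
    have "(\<Sum>A\<in>F1. f X1 A) + h (\<mu> B) (card X1) \<le> 2 * (1 - c) * card X1"
      unfolding h_def f_def
    proof (rule less.hyps[OF cards(1) finF(1) laminar_sub[OF sub(1)] _ finX(1)])
      show "\<mu> A < \<mu> A'" if "A \<in> F1" "A' \<in> F1" "A \<subset> A'" for A A'
        using less.prems(3) that sub by blast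
      show "card (X1 \<inter> A) \<le> \<mu> A" if "A \<in> F1" for A
        using X1[OF that] less.prems(5) that sub by auto
      show "\<mu> A < \<mu> B" if "A \<in> F1" for A
        using less.prems(3)[of A B] that B(1) unfolding F1_def by blast
    qed (rule m1)
    moreover have "f X B + h (\<mu> B + 1) (card X1) = h (\<mu> B) (card X1)"
    proof -
      obtain d where "\<mu> B = card X1 + d" using le_Suc_ex[OF m1] by auto
      then show ?thesis unfolding f_def h_def X1_def by (simp add: algebra_simps power_add)
    qed
    \<comment> \<open>\<open>h\<close> decreases in its first argument, and
      \<open>\<mu> B < M\<close> leaves room for the \<open>+ 1\<close>.\<close>
    moreover have "h M (card X1) \<le> h (\<mu> B + 1) (card X1)"
      unfolding h_def using pow_le c less.prems(6)[OF B(1)]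
      by (intro mult_left_mono add_left_mono power_decreasing) auto
    moreover have "(\<Sum>A\<in>F2. f X2 A) + h M (card X2) \<le> 2 * (1 - c) * card X2"
      unfolding h_def f_def
    proof (rule less.hyps[OF cards(2) finF(2) laminar_sub[OF sub(2)] _ finX(2)])
      show "\<mu> A < \<mu> A'" if "A \<in> F2" "A' \<in> F2" "A \<subset> A'" for A A'
        using less.prems(3) that sub by blast
      show "card (X2 \<inter> A) \<le> \<mu> A" if "A \<in> F2" for A
        using X2[OF that] less.prems(5) that sub by auto
      show "\<mu> A < M" if "A \<in> F2" for A using less.prems(6) that sub by auto
      show "card X2 \<le> M" using less.prems(7) cX by simp
    qed
    moreover have "h M (card X) \<le> h M (card X1) + h M (card X2)"
      using subadd less.prems(7) cX by metis
    moreover have "(\<Sum>A\<in>F. f X A) = f X B + (\<Sum>A\<in>F1. f X1 A) + (\<Sum>A\<in>F2. f X2 A)"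
    proof -
      have "(\<Sum>A\<in>F. f X A) = f X B + ((\<Sum>A\<in>F1. f X A) + (\<Sum>A\<in>F2. f X A))"
        unfolding F_eq(1) using finF sub F_eq(2) by (simp add: sum.union_disjoint)
      also have "(\<Sum>A\<in>F1. f X A) = (\<Sum>A\<in>F1. f X1 A)" unfolding f_def using X1 by simp
      also have "(\<Sum>A\<in>F2. f X A) = (\<Sum>A\<in>F2. f X2 A)" unfolding f_def using X2 by simp
      finally show ?thesis by simp
    qed
    ultimately have "(\<Sum>A\<in>F. f X A) + h M (card X) \<le> 2 * (1 - c) * card X"
      unfolding cX by (simp add: algebra_simps)
    then show ?thesis unfolding f_def h_def .
  qed
qed

lemma laminar_power_sum:
  fixes c :: real and \<mu> :: "'a set \<Rightarrow> nat"
  assumes c: "0 < c" "c < 1"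
    and F: "finite F" "laminar F"
    and mono: "\<And>A B. A \<in> F \<Longrightarrow> B \<in> F \<Longrightarrow> A \<subset> B \<Longrightarrow> \<mu> A < \<mu> B"
    and X: "finite X" "\<And>A. A \<in> F \<Longrightarrow> card (X \<inter> A) \<le> \<mu> A"
  shows "(\<Sum>A\<in>F. c ^ (\<mu> A - card (X \<inter> A)) * (1 - c ^ card (X \<inter> A))) \<le> 2 * card X"
proof -
  define M where "M = Max (insert (card X) ((\<lambda>A. \<mu> A + 1) ` F))"
  have fin: "finite (insert (card X) ((\<lambda>A. \<mu> A + 1) ` F))" using F by simp
  have "card X \<le> M" unfolding M_def using fin by (intro Max_ge) auto
  moreover have "\<mu> A < M" if "A \<in> F" for A
  proof -
    have "\<mu> A + 1 \<le> M" unfolding M_def using fin that by (intro Max_ge) auto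
    then show ?thesis by simp
  qed
  ultimately have "(\<Sum>A\<in>F. (1 - c) * c ^ (\<mu> A - card (X \<inter> A)) * (1 - c ^ card (X \<inter> A)))
           + (1 - c ^ card X) * (1 + c ^ (M - card X)) \<le> 2 * (1 - c) * card X"
    using laminar_power_sum_aux[OF c F mono X] by blast
  moreover have "0 \<le> (1 - c ^ card X) * (1 + c ^ (M - card X))"
    using c by (simp add: power_le_one)
  ultimately have "(\<Sum>A\<in>F. (1 - c) * c ^ (\<mu> A - card (X \<inter> A)) * (1 - c ^ card (X \<inter> A)))
     \<le> 2 * (1 - c) * card X" by linarith
  then have "(1 - c) * (\<Sum>A\<in>F. c ^ (\<mu> A - card (X \<inter> A)) * (1 - c ^ card (X \<inter> A)))
     \<le> 2 * (1 - c) * card X" by (simp add: sum_distrib_left mult.assoc)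
  moreover have "2 * (1 - c) * card X = (1 - c) * (2 * card X)" by simp
  ultimately have "(1 - c) * (\<Sum>A\<in>F. c ^ (\<mu> A - card (X \<inter> A)) * (1 - c ^ card (X \<inter> A)))
     \<le> (1 - c) * (2 * card X)" by (rule ord_le_eq_trans)
  then show ?thesis using c by (simp add: mult_le_cancel_left_pos)
qed

text \<open>By injectivity the numbers of heavier elements run through 0, ...,
  \<open>card Y - 1\<close>, so this is a finite geometric series. Removing the lightest element
  leaves the other ranks unchanged.\<close>

lemma sum_power_rank:
  fixes c :: real and w :: "'a \<Rightarrow> real"
  assumes "finite Y" "inj_on w Y" "card Y \<le> k"
  shows "(1 - c) * (\<Sum>x\<in>Y. c ^ (k - card {y\<in>Y. w x < w y} - 1)) = c ^ (k - card Y) * (1 - c ^ card Y)"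
  using assms
proof (induction "card Y" arbitrary: Y)
  case 0
  then show ?case by simp
next
  case (Suc n)
  then have "Y \<noteq> {}" by auto
  have "Min (w ` Y) \<in> w ` Y" using Suc.prems(1) \<open>Y \<noteq> {}\<close> by (intro Min_in) auto
  then obtain z where z: "z \<in> Y" "w z = Min (w ` Y)" by auto
  have min: "w z < w x" if "x \<in> Y - {z}" for x
  proof -
    have "w z \<le> w x" using z Suc.prems(1) that by simp
    moreover have "w z \<noteq> w x" using Suc.prems(2) z(1) that by (auto dest: inj_onD)
    ultimately show ?thesis by simp
  qed
  have card: "card (Y - {z}) = n" using Suc.hyps(2) z(1) Suc.prems(1) by simp
  have "{y\<in>Y. w z < w y} = Y - {z}" using min by auto
  then have hz: "card {y\<in>Y. w z < w y} = n" using card by simp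
  have hx: "{y\<in>Y. w x < w y} = {y\<in>Y - {z}. w x < w y}" if "x \<in> Y - {z}" for x
    using min[OF that] by auto
  have "(1 - c) * (\<Sum>x\<in>Y. c ^ (k - card {y\<in>Y. w x < w y} - 1)) =
     (1 - c) * c ^ (k - n - 1) + (1 - c) * (\<Sum>x\<in>Y - {z}. c ^ (k - card {y\<in>Y - {z}. w x < w y} - 1))"
    using hz hx by (simp add: sum.remove[OF Suc.prems(1) z(1)] algebra_simps)
  also have "(1 - c) * (\<Sum>x\<in>Y - {z}. c ^ (k - card {y\<in>Y - {z}. w x < w y} - 1))
      = c ^ (k - n) * (1 - c ^ n)"
    using Suc.hyps(1)[of "Y - {z}"] card Suc.prems Suc.hyps(2) by (auto simp: inj_on_diff)
  also have "(1 - c) * c ^ (k - n - 1) + c ^ (k - n) * (1 - c ^ n) = c ^ (k - card Y) * (1 - c ^ card Y)"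
  proof -
    obtain d where "k = Suc n + d" using le_Suc_ex[of "Suc n" k] Suc.prems(3) Suc.hyps(2) by auto
    then show ?thesis unfolding Suc.hyps(2)[symmetric] by (simp add: algebra_simps power_add)
  qed
  finally show ?case .
qed

text \<open>By Abel summation only superlevel sets \<open>Y\<close> of \<open>w\<close> with unit
  weights matter. An element of \<open>Y\<close> has the same heavier elements in \<open>X\<close>
  as in \<open>Y\<close>, so exchanging the two sums leaves a geometric series in each
  block.\<close>

lemma laminar_weighted_charging:
  fixes c :: real and \<mu> :: "'a set \<Rightarrow> nat" and w :: "'a \<Rightarrow> real"
  assumes c: "0 < c" "c < 1"
    and F: "finite F" "laminar F"
    and mono: "\<And>A B. A \<in> F \<Longrightarrow> B \<in> F \<Longrightarrow> A \<subset> B \<Longrightarrow> \<mu> A < \<mu> B"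
    and X: "finite X" "indep F \<mu> X"
    and w: "inj_on w X" "\<And>x. x \<in> X \<Longrightarrow> 0 \<le> w x"
  shows "(\<Sum>x\<in>X. w x * (\<Sum>A | A \<in> F \<and> x \<in> A. c ^ (\<mu> A - card {y\<in>X \<inter> A. w x < w y} - 1)))
           \<le> 2 / (1 - c) * (\<Sum>x\<in>X. w x)"
proof -
  define r where "r = (\<lambda>A x. c ^ (\<mu> A - card {y\<in>X \<inter> A. w x < w y} - 1))"
  define d where "d = (\<lambda>x. \<Sum>A | A \<in> F \<and> x \<in> A. r A x)"
  have "0 \<le> (\<Sum>x\<in>X. w x * (2 / (1 - c) - d x))"
  proof (rule abel_sum_nonneg[OF X(1) w(2)])
    fix \<theta>
    define Y where "Y = {x. x \<in> X \<and> \<theta> \<le> w x}"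
    have Y: "finite Y" "Y \<subseteq> X" using X(1) unfolding Y_def by auto
    have cY: "card (Y \<inter> A) \<le> \<mu> A" if "A \<in> F" for A
    proof -
      have "card (Y \<inter> A) \<le> card (X \<inter> A)" using X(1) Y by (intro card_mono) auto
      then show ?thesis using X(2) that unfolding indep_def by force
    qed
    have heavier: "{y\<in>X \<inter> A. w x < w y} = {y\<in>Y \<inter> A. w x < w y}" if "x \<in> Y" for x A
      using that unfolding Y_def by auto
    have "(1 - c) * (\<Sum>x\<in>Y. d x) = (\<Sum>A\<in>F. (1 - c) * (\<Sum>x\<in>Y \<inter> A. r A x))"
      unfolding d_def sum_distrib_left
      using sum.swap_restrict[OF Y(1) F(1), of "\<lambda>x A. (1 - c) * r A x" "\<lambda>x A. x \<in> A"]
      by (simp add: Int_def)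
    also have "\<dots> = (\<Sum>A\<in>F. c ^ (\<mu> A - card (Y \<inter> A)) * (1 - c ^ card (Y \<inter> A)))"
    proof (rule sum.cong[OF refl])
      fix A assume "A \<in> F"
      have "(\<Sum>x\<in>Y \<inter> A. r A x) = (\<Sum>x\<in>Y \<inter> A. c ^ (\<mu> A - card {y\<in>Y \<inter> A. w x < w y} - 1))"
        unfolding r_def using heavier by (intro sum.cong) auto
      then show "(1 - c) * (\<Sum>x\<in>Y \<inter> A. r A x) = c ^ (\<mu> A - card (Y \<inter> A)) * (1 - c ^ card (Y \<inter> A))"
        using sum_power_rank[of "Y \<inter> A" w "\<mu> A" c] Y w(1) cY[OF \<open>A \<in> F\<close>]
        by (simp add: inj_on_subset le_infI1)
    qed
    also have "\<dots> \<le> 2 * card Y" using laminar_power_sum[OF c F mono Y(1) cY] by blast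
    finally have "(\<Sum>x\<in>Y. d x) \<le> 2 / (1 - c) * card Y" using c by (simp add: field_simps)
    then have "0 \<le> (\<Sum>x\<in>Y. 2 / (1 - c) - d x)" by (simp add: sum_subtractf algebra_simps)
    then show "0 \<le> (\<Sum>x | x \<in> X \<and> \<theta> \<le> w x. 2 / (1 - c) - d x)" unfolding Y_def .
  qed
  moreover have "(\<Sum>x\<in>X. w x * (2 / (1 - c) - d x)) = 2 / (1 - c) * (\<Sum>x\<in>X. w x) - (\<Sum>x\<in>X. w x * d x)"
    unfolding right_diff_distrib sum_subtractf sum_distrib_left by (simp add: mult.commute)
  ultimately show ?thesis unfolding d_def r_def by simp
qed

section \<open>Maximum-weight bases of laminar matroids\<close>

locale laminar_instance =
  fixes U :: "'a set" and F :: "'a set set" and \<mu> :: "'a set \<Rightarrow> nat" and w :: "'a \<Rightarrow> real"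
  assumes finU: "finite U"
    and w_nonneg: "x \<in> U \<Longrightarrow> 0 \<le> w x"
    and w_inj: "inj_on w U"
    and lam: "laminar F"
    and F_sub: "A \<in> F \<Longrightarrow> A \<subseteq> U"
    and U_in: "U \<in> F"
    and mu_mono: "A \<in> F \<Longrightarrow> B \<in> F \<Longrightarrow> A \<subset> B \<Longrightarrow> \<mu> A < \<mu> B"
begin

lemma finF: "finite F"
  using finU F_sub by (meson Pow_iff finite_Pow_iff finite_subset subsetI)

lemma laminarD: "A \<in> F \<Longrightarrow> B \<in> F \<Longrightarrow> A \<subseteq> B \<or> B \<subseteq> A \<or> A \<inter> B = {}"
  using lam unfolding laminar_def by blast

lemma indepD: "indep F \<mu> X \<Longrightarrow> A \<in> F \<Longrightarrow> card (X \<inter> A) \<le> \<mu> A"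
  unfolding indep_def by blast

lemma indep_subset:
  assumes "indep F \<mu> X" "Y \<subseteq> X" "finite X"
  shows "indep F \<mu> Y"
  unfolding indep_def
proof
  fix A assume "A \<in> F"
  have "card (Y \<inter> A) \<le> card (X \<inter> A)" using assms by (intro card_mono) auto
  then show "card (Y \<inter> A) \<le> \<mu> A" using indepD[OF assms(1) \<open>A \<in> F\<close>] by simp
qed

text \<open>The maximal saturated blocks are disjoint by laminarity. In each of them
  \<open>Y\<close> has at most \<open>\<mu> A\<close> elements and \<open>G\<close> at least as
  many; outside all of them \<open>Y\<close> is contained in \<open>G\<close>.\<close>

lemma indep_card_le_spanning:
  assumes "finite Y" "finite G" "indep F \<mu> Y"
    and span: "\<And>y. y \<in> Y - G \<Longrightarrow> \<exists>A\<in>F. y \<in> A \<and> \<mu> A \<le> card (G \<inter> A)"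
  shows "card Y \<le> card G"
proof -
  define tight where "tight = {A\<in>F. \<mu> A \<le> card (G \<inter> A)}"
  define M where "M = {A\<in>tight. \<forall>A'\<in>tight. A \<subseteq> A' \<longrightarrow> A' = A}"
  have finT: "finite tight" unfolding tight_def using finF by simp
  have finM: "finite M" unfolding M_def using finT by simp
  have MF: "A \<in> F" "\<mu> A \<le> card (G \<inter> A)" if "A \<in> M" for A
    using that unfolding M_def tight_def by auto
  have disj: "A \<inter> B = {}" if "A \<in> M" "B \<in> M" "A \<noteq> B" for A B
    using that laminarD[of A B] unfolding M_def tight_def by blast
  have cover: "\<exists>A\<in>M. y \<in> A" if y: "y \<in> Y - G" for y
  proof -
    obtain A where A: "A \<in> tight" "y \<in> A" using span[OF y] unfolding tight_def by blast
    obtain A' where A': "A' \<in> tight" "A \<subseteq> A'" "\<forall>B\<in>tight. A' \<subseteq> B \<longrightarrow> A' = B"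
      using finite_has_maximal2[OF finT A(1)] by blast
    then show ?thesis using A unfolding M_def by blast
  qed
  have "card (Y \<inter> \<Union>M) \<le> (\<Sum>A\<in>M. card (Y \<inter> A))"
    unfolding Int_Union by (rule card_UN_le[OF finM])
  also have "\<dots> \<le> (\<Sum>A\<in>M. card (G \<inter> A))"
    using MF indepD[OF assms(3)] by (intro sum_mono) (meson le_trans)
  also have "\<dots> = card (\<Union>A\<in>M. G \<inter> A)"
    using finM disj assms(2) by (intro card_UN_disjoint[symmetric]) auto
  also have "\<dots> = card (G \<inter> \<Union>M)" unfolding Int_Union by (rule refl)
  finally have 1: "card (Y \<inter> \<Union>M) \<le> card (G \<inter> \<Union>M)" .
  have 2: "card (Y - \<Union>M) \<le> card (G - \<Union>M)"
    using cover assms(2) by (intro card_mono) auto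
  have "card Y = card (Y \<inter> \<Union>M) + card (Y - \<Union>M)"
    using card_Int_Diff[OF assms(1)] by simp
  moreover have "card G = card (G \<inter> \<Union>M) + card (G - \<Union>M)"
    using card_Int_Diff[OF assms(2)] by simp
  ultimately show ?thesis using 1 2 by simp
qed

text \<open>A local certificate of optimality: every rejected element lies in a block already filled
  by heavier ones. Unlike global maximality it is easily checked after deleting all elements below a
  threshold or adding a lightest one.\<close>

definition greedy_basis :: "'a set \<Rightarrow> 'a set \<Rightarrow> bool" where
  "greedy_basis V G \<longleftrightarrow> G \<subseteq> V \<and> indep F \<mu> G \<and>
     (\<forall>y\<in>V - G. \<exists>A\<in>F. y \<in> A \<and> \<mu> A \<le> card {z\<in>G \<inter> A. w y < w z})"

text \<open>Above the heaviest element \<open>v\<close> of the symmetric difference both sets agree.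
  So the block that rejects \<open>v\<close> from one set is filled by heavier elements in the other
  too, which also contains \<open>v\<close> and exceeds the capacity.\<close>

lemma greedy_basis_unique:
  assumes V: "V \<subseteq> U" and G: "greedy_basis V G" and G': "greedy_basis V G'"
  shows "G = G'"
proof (rule ccontr)
  assume "G \<noteq> G'"
  define D where "D = (G - G') \<union> (G' - G)"
  have subs: "G \<subseteq> V" "G' \<subseteq> V" using G G' unfolding greedy_basis_def by auto
  have finV: "finite V" using V finU finite_subset by blast
  have D: "finite D" "D \<noteq> {}" "D \<subseteq> U"
    using \<open>G \<noteq> G'\<close> subs V finV unfolding D_def by (auto intro: finite_subset[OF _ finV])
  have "Max (w ` D) \<in> w ` D" using D by (intro Max_in) auto
  then obtain v where "v \<in> D" "w v = Max (w ` D)" by auto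
  then have v: "v \<in> D" "\<And>u. u \<in> D \<Longrightarrow> w u \<le> w v" using D(1) by auto
  have eq: "z \<in> G \<longleftrightarrow> z \<in> G'" if "w v < w z" for z
    using v(2)[of z] that unfolding D_def by force
  have False if H: "greedy_basis V H" and H': "greedy_basis V H'" and "v \<in> H" "v \<notin> H'"
    and eq: "\<And>z. w v < w z \<Longrightarrow> z \<in> H \<longleftrightarrow> z \<in> H'" for H H'
  proof -
    have "v \<in> V - H'" using that unfolding greedy_basis_def by auto
    then obtain A where A: "A \<in> F" "v \<in> A" "\<mu> A \<le> card {z\<in>H' \<inter> A. w v < w z}"
      using H' unfolding greedy_basis_def by blast
    have "{z\<in>H' \<inter> A. w v < w z} = {z\<in>H \<inter> A. w v < w z}" using eq by auto
    moreover have "card {z\<in>H \<inter> A. w v < w z} < card (H \<inter> A)"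
      using A \<open>v \<in> H\<close> H finV unfolding greedy_basis_def
      by (intro psubset_card_mono) (auto intro: finite_subset)
    moreover have "card (H \<inter> A) \<le> \<mu> A" using H A(1) indepD unfolding greedy_basis_def by blast
    ultimately show False using A(3) by simp
  qed
  from this[OF G G' _ _ eq] this[OF G' G _ _ eq[symmetric]] v(1) show False
    unfolding D_def by blast
qed

text \<open>If \<open>y\<close> is not rejected by heavier elements, adding it or exchanging it for
  a lighter \<open>z\<close> improves \<open>X\<close>. Taking \<open>z\<close> from the smallest
  tight block around \<open>y\<close> keeps independence: larger blocks around \<open>y\<close>
  contain both elements, and a block around \<open>y\<close> but not \<open>z\<close> lies strictly
  inside and has room.\<close>

lemma lex_max_greedy_basis:
  assumes V: "V \<subseteq> U" and X: "X \<subseteq> V" "indep F \<mu> X"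
    and opt: "\<And>Y. Y \<subseteq> V \<Longrightarrow> indep F \<mu> Y \<Longrightarrow>
       wsum w Y < wsum w X \<or> (wsum w Y = wsum w X \<and> card Y \<le> card X)"
  shows "greedy_basis V X"
  unfolding greedy_basis_def
proof (intro conjI X ballI, rule ccontr)
  fix y assume y: "y \<in> V - X" and no: "\<not> (\<exists>A\<in>F. y \<in> A \<and> \<mu> A \<le> card {z\<in>X \<inter> A. w y < w z})"
  have finX: "finite X" using X V finU by (meson finite_subset)
  define tight where "tight = {A\<in>F. y \<in> A \<and> \<mu> A \<le> card (X \<inter> A)}"
  have ins: "card (insert y Z \<inter> A) = (if y \<in> A then Suc (card (Z \<inter> A)) else card (Z \<inter> A))"
    if "Z \<subseteq> X" for Z A
  proof -
    have "finite (Z \<inter> A)" "y \<notin> Z" using that y finite_subset[OF that finX] by auto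
    then show ?thesis by (auto simp: Int_insert_left)
  qed
  show False
  proof (cases "tight = {}")
    case True
    have "indep F \<mu> (insert y X)"
      unfolding indep_def
    proof
      fix A assume "A \<in> F"
      then show "card (insert y X \<inter> A) \<le> \<mu> A"
        using True indepD[OF X(2) \<open>A \<in> F\<close>] ins[of X A] unfolding tight_def by force
    qed
    moreover have "wsum w (insert y X) = w y + wsum w X" "card (insert y X) = Suc (card X)"
      using y finX unfolding wsum_def by auto
    moreover have "0 \<le> w y" using y V w_nonneg by auto
    \<comment> \<open>For \<open>w y = 0\<close> the weights tie, and the cardinality clause gives
      the contradiction.\<close>
    ultimately show False using opt[of "insert y X"] y X(1) by auto
  next
    case False
    have "finite tight" unfolding tight_def using finF by simp
    then obtain A where A: "A \<in> tight" "\<And>A'. A' \<in> tight \<Longrightarrow> A' \<subseteq> A \<Longrightarrow> A' = A"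
      using finite_has_minimal[of tight] False by blast
    have AF: "A \<in> F" "y \<in> A" "\<mu> A \<le> card (X \<inter> A)" using A(1) unfolding tight_def by auto
    have "{z\<in>X \<inter> A. w y < w z} \<noteq> X \<inter> A" using no AF by auto
    then obtain z where "z \<in> X \<inter> A" "\<not> w y < w z" by blast
    then have z: "z \<in> X" "z \<in> A" "w z \<le> w y" by auto
    have "w z \<noteq> w y" using z y X V inj_onD[OF w_inj, of z y] by auto
    then have wz: "w z < w y" using z by simp
    define Y where "Y = insert y (X - {z})"
    have "indep F \<mu> Y"
      unfolding indep_def
    proof
      fix B assume B: "B \<in> F"
      have cB: "card (X \<inter> B) \<le> \<mu> B" using indepD[OF X(2) B] .
      show "card (Y \<inter> B) \<le> \<mu> B"
      proof (cases "y \<in> B")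
        case False
        then have "card (Y \<inter> B) \<le> card (X \<inter> B)"
          unfolding Y_def using finX by (intro card_mono) auto
        then show ?thesis using cB by simp
      next
        case yB: True
        have eq: "card (Y \<inter> B) = Suc (card ((X - {z}) \<inter> B))"
          unfolding Y_def using ins[of "X - {z}" B] yB by auto
        show ?thesis
        proof (cases "z \<in> B")
          case True
          then have "(X - {z}) \<inter> B = (X \<inter> B) - {z}" "z \<in> X \<inter> B" using z by auto
          then have "Suc (card ((X - {z}) \<inter> B)) = card (X \<inter> B)"
            using finX by (metis card_Suc_Diff1 finite_Int)
          then show ?thesis using eq cB by simp
        next
          case False
          then have "B \<subseteq> A" "B \<noteq> A" using laminarD[OF B AF(1)] yB AF(2) z by auto
          then have "B \<notin> tight" using A(2) by blast
          then have "card (X \<inter> B) < \<mu> B" unfolding tight_def using B yB by auto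
          moreover have "card ((X - {z}) \<inter> B) \<le> card (X \<inter> B)" using finX by (intro card_mono) auto
          ultimately show ?thesis using eq by simp
        qed
      qed
    qed
    moreover have "Y \<subseteq> V" unfolding Y_def using y X by auto
    moreover have "wsum w Y = w y + (wsum w X - w z)"
      unfolding Y_def wsum_def using y finX z by (simp add: sum_diff1)
    ultimately show False using opt[of Y] wz by auto
  qed
qed

lemma lex_max_exists:
  assumes "finite V"
  obtains X where "X \<subseteq> V" "indep F \<mu> X" "\<And>Y. Y \<subseteq> V \<Longrightarrow> indep F \<mu> Y \<Longrightarrow>
       wsum w Y < wsum w X \<or> (wsum w Y = wsum w X \<and> card Y \<le> card X)"
proof -
  define I where "I = {X. X \<subseteq> V \<and> indep F \<mu> X}"
  have I: "finite I" "I \<noteq> {}" unfolding I_def indep_def using assms by (auto intro: exI[of _ "{}"])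
  define J where "J = {X\<in>I. wsum w X = Max (wsum w ` I)}"
  have "Max (wsum w ` I) \<in> wsum w ` I" using I by (intro Max_in) auto
  then have J: "finite J" "J \<noteq> {}" unfolding J_def using I(1) by auto
  have "Max (card ` J) \<in> card ` J" using J by (intro Max_in) auto
  then obtain X where X: "X \<in> J" "card X = Max (card ` J)" by auto
  show thesis
  proof (rule that)
    show "X \<subseteq> V" "indep F \<mu> X" using X unfolding J_def I_def by auto
    fix Y assume "Y \<subseteq> V" "indep F \<mu> Y"
    then have Y: "Y \<in> I" unfolding I_def by auto
    have "wsum w Y \<le> wsum w X" using Y X(1) I(1) unfolding J_def by simp
    moreover have "card Y \<le> card X" if "wsum w Y = wsum w X"
    proof -
      have "Y \<in> J" using that Y X(1) unfolding J_def by auto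
      then show ?thesis using X(2) J(1) by simp
    qed
    ultimately show "wsum w Y < wsum w X \<or> (wsum w Y = wsum w X \<and> card Y \<le> card X)" by force
  qed
qed

lemma OPT_greedy_basis:
  assumes "V \<inter> B \<subseteq> U"
  shows "greedy_basis (V \<inter> B) (OPT F \<mu> w V B)"
proof -
  have fin: "finite (V \<inter> B)" using assms finU finite_subset by blast
  obtain X where X: "X \<subseteq> V \<inter> B" "indep F \<mu> X" "\<And>Y. Y \<subseteq> V \<inter> B \<Longrightarrow> indep F \<mu> Y \<Longrightarrow>
       wsum w Y < wsum w X \<or> (wsum w Y = wsum w X \<and> card Y \<le> card X)"
    using lex_max_exists[OF fin] by blast
  have gX: "greedy_basis (V \<inter> B) X" using lex_max_greedy_basis[OF assms X] .
  have "OPT F \<mu> w V B = X"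
    unfolding OPT_def
  proof (rule the_equality)
    show "X \<subseteq> V \<inter> B \<and> indep F \<mu> X \<and> (\<forall>Y. Y \<subseteq> V \<inter> B \<and> indep F \<mu> Y \<longrightarrow>
         wsum w Y < wsum w X \<or> (wsum w Y = wsum w X \<and> card Y \<le> card X))" using X by blast
  next
    fix Z assume "Z \<subseteq> V \<inter> B \<and> indep F \<mu> Z \<and> (\<forall>Y. Y \<subseteq> V \<inter> B \<and> indep F \<mu> Y \<longrightarrow>
         wsum w Y < wsum w Z \<or> (wsum w Y = wsum w Z \<and> card Y \<le> card Z))"
    then have "greedy_basis (V \<inter> B) Z" using lex_max_greedy_basis[OF assms, of Z] by blast
    then show "Z = X" using greedy_basis_unique[OF assms _ gX] by blast
  qed
  then show ?thesis using gX by simp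
qed

lemma OPT_eqI: "V \<inter> B \<subseteq> U \<Longrightarrow> greedy_basis (V \<inter> B) G \<Longrightarrow> OPT F \<mu> w V B = G"
  using OPT_greedy_basis greedy_basis_unique by blast

lemma OPT_subset: "V \<inter> B \<subseteq> U \<Longrightarrow> OPT F \<mu> w V B \<subseteq> V \<inter> B"
  and OPT_indep: "V \<inter> B \<subseteq> U \<Longrightarrow> indep F \<mu> (OPT F \<mu> w V B)"
  using OPT_greedy_basis unfolding greedy_basis_def by blast+

lemma OPT_spanning: "V \<inter> B \<subseteq> U \<Longrightarrow> y \<in> V \<inter> B \<Longrightarrow> y \<notin> OPT F \<mu> w V B \<Longrightarrow>
    \<exists>A\<in>F. y \<in> A \<and> \<mu> A \<le> card {z\<in>OPT F \<mu> w V B \<inter> A. w y < w z}"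
  using OPT_greedy_basis unfolding greedy_basis_def by blast

lemma OPT_finite: "V \<inter> B \<subseteq> U \<Longrightarrow> finite (OPT F \<mu> w V B)"
  using OPT_subset finU by (meson finite_subset)

lemma OPT_card: "V \<subseteq> U \<Longrightarrow> B \<in> F \<Longrightarrow> card (OPT F \<mu> w V B) \<le> \<mu> B"
  using indepD[OF OPT_indep[of V B], of B] OPT_subset[of V B] by (simp add: Int_absorb2 le_infI1)

text \<open>The certificate of an element heavier than \<open>\<theta>\<close> mentions only still
  heavier ones, so it survives the deletion of the rest: greedy choices never depend on lighter
  elements.\<close>

lemma OPT_heavier:
  assumes "V \<inter> B \<subseteq> U"
  shows "OPT F \<mu> w {v\<in>V. \<theta> < w v} B = {z\<in>OPT F \<mu> w V B. \<theta> < w z}"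
proof (rule OPT_eqI)
  show "{v\<in>V. \<theta> < w v} \<inter> B \<subseteq> U" using assms by auto
  have "indep F \<mu> {z\<in>OPT F \<mu> w V B. \<theta> < w z}"
    by (rule indep_subset[OF OPT_indep[OF assms] _ OPT_finite[OF assms]]) auto
  moreover have "\<exists>A\<in>F. y \<in> A \<and> \<mu> A \<le> card {z\<in>{z\<in>OPT F \<mu> w V B. \<theta> < w z} \<inter> A. w y < w z}"
    if "y \<in> ({v\<in>V. \<theta> < w v} \<inter> B) - {z\<in>OPT F \<mu> w V B. \<theta> < w z}" for y
  proof -
    have y: "y \<in> V \<inter> B" "y \<notin> OPT F \<mu> w V B" "\<theta> < w y" using that by auto
    obtain A where "A\<in>F" "y \<in> A" "\<mu> A \<le> card {z\<in>OPT F \<mu> w V B \<inter> A. w y < w z}"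
      using OPT_spanning[OF assms y(1,2)] by blast
    moreover have "{z\<in>{z\<in>OPT F \<mu> w V B. \<theta> < w z} \<inter> A. w y < w z} = {z\<in>OPT F \<mu> w V B \<inter> A. w y < w z}"
      using y(3) by auto
    ultimately show ?thesis by auto
  qed
  ultimately show "greedy_basis ({v\<in>V. \<theta> < w v} \<inter> B) {z\<in>OPT F \<mu> w V B. \<theta> < w z}"
    using OPT_subset[OF assms] unfolding greedy_basis_def by auto
qed

section \<open>Samples read by decreasing weight\<close>

definition heads :: "'a set \<Rightarrow> 'a set \<Rightarrow> 'a \<Rightarrow> nat" where
  "heads S B j = card {s\<in>OPT F \<mu> w S B. w j < w s}"

text \<open>A sufficient condition for \<open>j\<close> to be accepted by the greedy algorithm on
  \<open>insert j S \<inter> B\<close>, and a necessary one for KickNext to let \<open>j\<close> kick at \<open>B\<close>.\<close>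

definition cand :: "'a set \<Rightarrow> 'a set \<Rightarrow> 'a \<Rightarrow> bool" where
  "cand S B j \<longleftrightarrow> (\<forall>A\<in>F. j \<in> A \<and> A \<subseteq> B \<longrightarrow> heads S A j < \<mu> A)"

text \<open>The candidates that come after the first \<open>\<mu> B - m\<close> heads of \<open>B\<close>
  (stated without truncated subtraction).\<close>

definition tails :: "'a set \<Rightarrow> 'a set \<Rightarrow> 'a set \<Rightarrow> nat \<Rightarrow> 'a set" where
  "tails S E B m = {j\<in>E \<inter> B. cand S B j \<and> \<mu> B \<le> heads S B j + m}"

text \<open>Only sampled elements heavier than \<open>j\<close> enter, which allows labels to be
  revealed by decreasing weight.\<close>

lemma heads_eq: "S \<subseteq> U \<Longrightarrow> heads S B j = card (OPT F \<mu> w {v\<in>S. w j < w v} B)"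
  unfolding heads_def by (subst OPT_heavier) auto

lemma heads_insert_lighter:
  assumes "insert i S \<subseteq> U" "w i < w j"
  shows "heads (insert i S) B j = heads S B j"
proof -
  have "{v\<in>insert i S. w j < w v} = {v\<in>S. w j < w v}" using assms by auto
  moreover have "S \<subseteq> U" using assms by auto
  ultimately show ?thesis using heads_eq[OF assms(1), of B j] heads_eq[of S B j] by simp
qed

lemma heads_lightest:
  assumes "S \<subseteq> U" "\<And>s. s \<in> S \<Longrightarrow> w j < w s"
  shows "heads S B j = card (OPT F \<mu> w S B)"
proof -
  have "{s\<in>OPT F \<mu> w S B. w j < w s} = OPT F \<mu> w S B" using OPT_subset[of S B] assms by auto
  then show ?thesis unfolding heads_def by simp
qed

lemma OPT_insert_lightest_mono:
  assumes "insert j S \<subseteq> U" "\<And>s. s \<in> S \<Longrightarrow> w j < w s"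
  shows "card (OPT F \<mu> w S B) \<le> card (OPT F \<mu> w (insert j S) B)"
proof -
  have "{v\<in>insert j S. w j < w v} = S" using assms by auto
  then have "OPT F \<mu> w S B = {z\<in>OPT F \<mu> w (insert j S) B. w j < w z}"
    using OPT_heavier[of "insert j S" B "w j"] assms by auto
  then have "OPT F \<mu> w S B \<subseteq> OPT F \<mu> w (insert j S) B" by auto
  then show ?thesis using OPT_finite[of "insert j S" B] assms by (intro card_mono) auto
qed

text \<open>Independence is the point. For a block \<open>A\<close> around \<open>j\<close> inside
  \<open>B\<close>, \<open>OPT\<close> of \<open>A\<close> spans \<open>S \<inter> A\<close>, so
  \<open>OPT\<close> of \<open>B\<close> meets \<open>A\<close> in at most
  \<open>heads S A j < \<mu> A\<close> elements. A block strictly around \<open>B\<close> has larger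
  capacity than \<open>B\<close>, where \<open>j\<close> still fits.\<close>

lemma OPT_insert_cand:
  assumes jS: "insert j S \<subseteq> U" and light: "\<And>s. s \<in> S \<Longrightarrow> w j < w s"
    and B: "B \<in> F" and j: "j \<in> B" and c: "cand S B j"
  shows "OPT F \<mu> w (insert j S) B = insert j (OPT F \<mu> w S B)"
proof (rule OPT_eqI)
  let ?G = "OPT F \<mu> w S B"
  show "insert j S \<inter> B \<subseteq> U" using jS by auto
  have SB: "S \<inter> A \<subseteq> U" for A using jS by auto
  have jn: "j \<notin> ?G" using OPT_subset[OF SB] light by fastforce
  have lt: "card (OPT F \<mu> w S A) < \<mu> A" if "A \<in> F" "j \<in> A" "A \<subseteq> B" for A
    using c that heads_lightest[of S j A] jS light unfolding cand_def by auto
  have ind: "indep F \<mu> (insert j ?G)"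
    unfolding indep_def
  proof
    fix A assume A: "A \<in> F"
    show "card (insert j ?G \<inter> A) \<le> \<mu> A"
    proof (cases "j \<in> A")
      case False
      then show ?thesis using indepD[OF OPT_indep[OF SB] A] by simp
    next
      case True
      have eq: "card (insert j ?G \<inter> A) = Suc (card (?G \<inter> A))"
        using True jn OPT_finite[OF SB] by simp
      consider "A \<subseteq> B" | "B \<subset> A" using laminarD[OF A B] True j by auto
      then have "card (?G \<inter> A) < \<mu> A"
      proof cases
        case 1
        have "card (?G \<inter> A) \<le> card (OPT F \<mu> w S A)"
        proof (rule indep_card_le_spanning)
          show "finite (?G \<inter> A)" "finite (OPT F \<mu> w S A)" using OPT_finite[OF SB] by auto
          show "indep F \<mu> (?G \<inter> A)"
            by (rule indep_subset[OF OPT_indep[OF SB] _ OPT_finite[OF SB]]) (rule Int_lower1)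
          fix y assume y: "y \<in> ?G \<inter> A - OPT F \<mu> w S A"
          then have "y \<in> S \<inter> A" using OPT_subset[OF SB] by auto
          then obtain A' where A': "A' \<in> F" "y \<in> A'" "\<mu> A' \<le> card {z\<in>OPT F \<mu> w S A \<inter> A'. w y < w z}"
            using OPT_spanning[OF SB] y by blast
          moreover have "card {z\<in>OPT F \<mu> w S A \<inter> A'. w y < w z} \<le> card (OPT F \<mu> w S A \<inter> A')"
            using OPT_finite[OF SB] by (intro card_mono) auto
          ultimately show "\<exists>A'\<in>F. y \<in> A' \<and> \<mu> A' \<le> card (OPT F \<mu> w S A \<inter> A')" by force
        qed
        then show ?thesis using lt[OF A True 1] by simp
      next
        case 2
        have "card (?G \<inter> A) \<le> card ?G" using OPT_finite[OF SB] by (intro card_mono) auto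
        also have "\<dots> < \<mu> B" using lt[OF B j] by simp
        also have "\<dots> < \<mu> A" using mu_mono[OF B A 2] .
        finally show ?thesis .
      qed
      then show ?thesis using eq by simp
    qed
  qed
  moreover have "\<exists>A\<in>F. y \<in> A \<and> \<mu> A \<le> card {z\<in>insert j ?G \<inter> A. w y < w z}"
    if y: "y \<in> insert j S \<inter> B - insert j ?G" for y
  proof -
    obtain A where A: "A \<in> F" "y \<in> A" "\<mu> A \<le> card {z\<in>?G \<inter> A. w y < w z}"
      using OPT_spanning[OF SB, of y B] y by blast
    have "card {z\<in>?G \<inter> A. w y < w z} \<le> card {z\<in>insert j ?G \<inter> A. w y < w z}"
      using OPT_finite[OF SB] by (intro card_mono) auto
    then show ?thesis using A by force
  qed
  ultimately show "greedy_basis (insert j S \<inter> B) (insert j ?G)"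
    unfolding greedy_basis_def using OPT_subset[OF SB] j by auto
qed

text \<open>The elements of \<open>OPT\<close> in \<open>B\<close> above \<open>x\<close> span the
  part of the sampled optimum above \<open>x\<close>: a block rejecting \<open>y\<close> cannot
  contain \<open>x\<close>, as it would be overfull, hence lies inside \<open>B\<close> by
  laminarity. This yields the lower end of the range of \<open>m\<close>.\<close>

lemma heads_le_OPT_heavier:
  assumes S: "S \<subseteq> U" and B: "B \<in> F" and x: "x \<in> OPT F \<mu> w U U" "x \<in> B"
  shows "heads S B x \<le> card {y\<in>OPT F \<mu> w U U \<inter> B. w x < w y}"
  unfolding heads_def
proof (rule indep_card_le_spanning)
  let ?O = "OPT F \<mu> w U U"
  have finO: "finite ?O" using OPT_finite[of U U] by simp
  have SB: "S \<inter> B \<subseteq> U" using S by auto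
  show "finite {s\<in>OPT F \<mu> w S B. w x < w s}" using OPT_finite[OF SB] by simp
  show "finite {y\<in>?O \<inter> B. w x < w y}" using finO by simp
  show "indep F \<mu> {s\<in>OPT F \<mu> w S B. w x < w s}"
    by (rule indep_subset[OF OPT_indep[OF SB] _ OPT_finite[OF SB]]) auto
  fix y assume y: "y \<in> {s\<in>OPT F \<mu> w S B. w x < w s} - {y\<in>?O \<inter> B. w x < w y}"
  then have yB: "y \<in> B" "w x < w y" "y \<notin> ?O" "y \<in> U" using OPT_subset[OF SB] S by auto
  then obtain A where A: "A \<in> F" "y \<in> A" "\<mu> A \<le> card {z\<in>?O \<inter> A. w y < w z}"
    using OPT_spanning[of U U y] by auto
  have le: "card {z\<in>?O \<inter> A. w y < w z} \<le> card {z\<in>?O \<inter> A. w x < w z}"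
    using finO yB by (intro card_mono) auto
  have "x \<notin> A"
  proof
    assume "x \<in> A"
    then have "card {z\<in>?O \<inter> A. w x < w z} < card (?O \<inter> A)"
      using finO x by (intro psubset_card_mono) auto
    then show False using A(3) le indepD[OF OPT_indep[of U U] A(1)] by simp
  qed
  then have "A \<subseteq> B" using laminarD[OF A(1) B] A(2) yB(1) x(2) by auto
  then have "{z\<in>?O \<inter> A. w x < w z} = {y\<in>?O \<inter> B. w x < w y} \<inter> A" by auto
  then show "\<exists>A\<in>F. y \<in> A \<and> \<mu> A \<le> card ({y\<in>?O \<inter> B. w x < w y} \<inter> A)"
    using A le by (intro bexI[of _ A]) auto
qed

end

section \<open>Failures of KickNext\<close>

lemma finite_chain_sorted_list:
  assumes "finite C" "\<And>A B. A \<in> C \<Longrightarrow> B \<in> C \<Longrightarrow> A \<subseteq> B \<or> B \<subseteq> A"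
  shows "\<exists>xs. set xs = C \<and> sorted_wrt (\<subset>) xs"
  using assms
proof (induction C rule: finite_psubset_induct)
  case (psubset C)
  show ?case
  proof (cases "C = {}")
    case False
    obtain M where M: "M \<in> C" "\<forall>A\<in>C. M \<subseteq> A \<longrightarrow> M = A"
      using finite_has_maximal[OF psubset.hyps(1) False] by blast
    have "\<exists>xs. set xs = C - {M} \<and> sorted_wrt (\<subset>) xs"
      using M(1) psubset.prems by (intro psubset.IH) auto
    then obtain xs where xs: "set xs = C - {M}" "sorted_wrt (\<subset>) xs" by blast
    have "A \<subset> M" if "A \<in> C - {M}" for A using psubset.prems[of A M] M that by blast
    then have "sorted_wrt (\<subset>) (xs @ [M])" using xs by (simp add: sorted_wrt_append)
    moreover have "set (xs @ [M]) = C" using xs M by auto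
    ultimately show ?thesis by blast
  qed simp
qed

lemma arg_max_props:
  fixes w :: "'a \<Rightarrow> real"
  assumes "finite X" "\<exists>x\<in>X. w x < a"
  defines "z \<equiv> (ARG_MAX w x. x \<in> X \<and> w x < a)"
  shows "z \<in> X" "w z < a" "\<And>y. y \<in> X \<Longrightarrow> w y < a \<Longrightarrow> w y \<le> w z"
proof -
  let ?L = "{x\<in>X. w x < a}"
  have L: "finite ?L" "?L \<noteq> {}" using assms by auto
  have "Max (w ` ?L) \<in> w ` ?L" using L by (intro Max_in) auto
  then obtain u where u: "u \<in> ?L" "w u = Max (w ` ?L)" by auto
  have "\<not> w u < w y" if "y \<in> X" "w y < a" for y using that u L(1) by (simp add: not_less)
  then have "is_arg_max w (\<lambda>x. x \<in> X \<and> w x < a) u"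
    using u(1) unfolding is_arg_max_def by blast
  then have "is_arg_max w (\<lambda>x. x \<in> X \<and> w x < a) z"
    unfolding z_def arg_max_def by (rule someI)
  then show "z \<in> X" "w z < a" "\<And>y. y \<in> X \<Longrightarrow> w y < a \<Longrightarrow> w y \<le> w z"
    unfolding is_arg_max_def by (auto simp: not_less)
qed

lemma process_chain_mono: "snd st B \<subseteq> snd (process_chain w i Bs st) B"
proof (induction Bs arbitrary: st)
  case (Cons A Bs)
  obtain R SOL where st: "st = (R, SOL)" by (cases st)
  show ?case
  proof (cases "kick w R A i")
    case (Some R')
    have "SOL B \<subseteq> snd (R', SOL(A := insert i (SOL A))) B" by auto
    also have "\<dots> \<subseteq> snd (process_chain w i Bs (R', SOL(A := insert i (SOL A)))) B" by (rule Cons.IH)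
    finally show ?thesis using Some by (simp add: st)
  qed (simp add: st)
qed simp

lemma process_chain_subset: "snd (process_chain w i Bs st) B \<subseteq> insert i (snd st B)"
proof (induction Bs arbitrary: st)
  case (Cons A Bs)
  obtain R SOL where st: "st = (R, SOL)" by (cases st)
  show ?case
  proof (cases "kick w R A i")
    case (Some R')
    have "snd (process_chain w i Bs (R', SOL(A := insert i (SOL A)))) B
        \<subseteq> insert i (snd (R', SOL(A := insert i (SOL A))) B)" by (rule Cons.IH)
    also have "\<dots> \<subseteq> insert i (SOL B)" by auto
    finally show ?thesis using Some by (simp add: st)
  qed (auto simp: st)
qed auto

lemma fold_process_chain_mono:
  "snd st B \<subseteq> snd (fold (\<lambda>i. process_chain w i (L i)) ys st) B"
proof (induction ys arbitrary: st)
  case (Cons i ys)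
  show ?case
    using subset_trans[OF process_chain_mono[of st B w i "L i"] Cons.IH[of "process_chain w i (L i) st"]] by simp
qed simp

context laminar_instance
begin

lemma chain_list_props:
  assumes "i \<in> U"
  defines "Bs \<equiv> chain_list F (minset F i) U"
  shows "set Bs = {A\<in>F. i \<in> A}" "sorted_wrt (\<subset>) Bs"
proof -
  let ?C = "{A\<in>F. i \<in> A}"
  have C: "finite ?C" "?C \<noteq> {}" using finF U_in assms by auto
  obtain M where M: "M \<in> ?C" "\<forall>A\<in>?C. A \<subseteq> M \<longrightarrow> M = A"
    using finite_has_minimal[OF C] by blast
  have chain: "A \<subseteq> B \<or> B \<subseteq> A" if "A \<in> ?C" "B \<in> ?C" for A B
    using laminarD[of A B] that by auto
  have le: "M \<subseteq> A" if "A \<in> ?C" for A using chain[OF M(1) that] M(2) that by auto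
  have "minset F i = M"
    unfolding minset_def using M(1) le by (intro the_equality) blast+
  then have eq: "{B'\<in>F. minset F i \<subseteq> B' \<and> B' \<subseteq> U} = ?C" using M le F_sub by blast
  have "set Bs = ?C \<and> sorted_wrt (\<subset>) Bs"
    unfolding Bs_def chain_list_def eq
    by (rule someI_ex) (use finite_chain_sorted_list[OF C(1)] chain in blast)
  then show "set Bs = ?C" "sorted_wrt (\<subset>) Bs" by auto
qed

section \<open>Parking in the slots of one block\<close>

text \<open>Parking invariant at \<open>B\<close>: \<open>st\<close> is \<open>R(B)\<close>, \<open>K\<close> the set of
  elements that have kicked at \<open>B\<close>.  Since every element parks in the next free slot below it,
  the used slots below a free slot \<open>y\<close> were used by elements below \<open>y\<close>.\<close>

definition slot_inv :: "'a set \<Rightarrow> 'a set \<Rightarrow> 'a set \<Rightarrow> 'a set \<times> nat \<Rightarrow> 'a set \<Rightarrow> bool" where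
  "slot_inv S Y B st K \<longleftrightarrow> (case st of (X, d) \<Rightarrow>
     X \<subseteq> OPT F \<mu> w S B \<and> d \<le> \<mu> B - card (OPT F \<mu> w S B) \<and>
     K \<subseteq> {j\<in>Y \<inter> B. cand S B j} \<and>
     card (OPT F \<mu> w S B - X) + (\<mu> B - card (OPT F \<mu> w S B)) \<le> card K + d \<and>
     (\<forall>y\<in>X. card {s\<in>OPT F \<mu> w S B - X. w s < w y} + (\<mu> B - card (OPT F \<mu> w S B))
              \<le> card {j\<in>K. w j < w y} + d))"

text \<open>In subtraction-free form, the invariant says that used slots below a free
  \<open>y\<close>, plus used dummies, are at most the kickers below \<open>y\<close>. A newly used
  \<open>z\<close> below \<open>y\<close> is matched by \<open>i\<close>: \<open>z\<close> is the
  highest free slot below \<open>i\<close>, so the free \<open>y\<close> above \<open>z\<close> is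
  above \<open>i\<close>. A dummy lies below every \<open>y\<close>, but it is used only when all
  free slots are above \<open>i\<close>.\<close>

lemma slot_inv_kick:
  assumes S: "S \<subseteq> U" and Y: "Y \<subseteq> U" "Y \<inter> S = {}" and i: "i \<in> Y" "i \<in> B" "i \<notin> K" "cand S B i"
    and inv: "slot_inv S Y B (R B) K" and kick: "kick w R B i = Some R'"
  shows "slot_inv S Y B (R' B) (insert i K)"
proof -
  obtain X d where R: "R B = (X, d)" by (cases "R B")
  let ?O = "OPT F \<mu> w S B"
  have X: "X \<subseteq> ?O" and d: "d \<le> \<mu> B - card ?O" and K: "K \<subseteq> {j\<in>Y \<inter> B. cand S B j}"
    and tot: "card (?O - X) + (\<mu> B - card ?O) \<le> card K + d"
    and pre: "\<And>y. y \<in> X \<Longrightarrow> card {s\<in>?O - X. w s < w y} + (\<mu> B - card ?O) \<le> card {j\<in>K. w j < w y} + d"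
    using inv unfolding slot_inv_def R by auto
  have SB: "S \<inter> B \<subseteq> U" using S by auto
  have finO: "finite ?O" using OPT_finite[OF SB] .
  have finX: "finite X" using X finO finite_subset by blast
  have "finite Y" using Y(1) finU finite_subset by blast
  then have finK: "finite K" using K finite_subset by (metis (no_types, lifting) Int_iff mem_Collect_eq subset_iff)
  have K': "insert i K \<subseteq> {j\<in>Y \<inter> B. cand S B j}" using K i by auto
  have cK: "card (insert i K) = Suc (card K)" using finK i(3) by simp
  have neq: "w y \<noteq> w i" if "y \<in> X" for y
  proof -
    have "y \<in> S" using that X OPT_subset[OF SB] by auto
    then have "y \<noteq> i" "y \<in> U" "i \<in> U" using Y i(1) S by auto
    then show ?thesis using w_inj by (auto dest: inj_onD)
  qed
  have up: "card {j\<in>insert i K. w j < w y} = Suc (card {j\<in>K. w j < w y})" if "w i < w y" for y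
  proof -
    have "{j\<in>insert i K. w j < w y} = insert i {j\<in>K. w j < w y}" using that by auto
    then show ?thesis using finK i(3) by simp
  qed
  show ?thesis
  proof (cases "\<exists>x\<in>X. w x < w i")
    case True
    define z where "z = (ARG_MAX w x. x \<in> X \<and> w x < w i)"
    have R': "R' B = (X - {z}, d)" using kick True unfolding kick_def R z_def by auto
    have z: "z \<in> X" "w z < w i" "\<And>y. y \<in> X \<Longrightarrow> w y < w i \<Longrightarrow> w y \<le> w z"
      using arg_max_props[OF finX True] unfolding z_def by blast+
    have O_eq: "?O - (X - {z}) = insert z (?O - X)" using z(1) X by auto
    have "card (?O - (X - {z})) = Suc (card (?O - X))" unfolding O_eq using finO z(1) by simp
    moreover have "card {s\<in>?O - (X - {z}). w s < w y} + (\<mu> B - card ?O) \<le> card {j\<in>insert i K. w j < w y} + d"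
      if y: "y \<in> X - {z}" for y
    proof (cases "w z < w y")
      case True
      then have "w i < w y" using z(3)[of y] neq[of y] y by force
      moreover have "{s\<in>?O - (X - {z}). w s < w y} = insert z {s\<in>?O - X. w s < w y}"
        unfolding O_eq using True by auto
      moreover have "card (insert z {s\<in>?O - X. w s < w y}) = Suc (card {s\<in>?O - X. w s < w y})"
        using finO z(1) by simp
      ultimately show ?thesis using pre[of y] up[of y] y by simp
    next
      case False
      then have "{s\<in>?O - (X - {z}). w s < w y} = {s\<in>?O - X. w s < w y}" unfolding O_eq by auto
      moreover have "card {j\<in>K. w j < w y} \<le> card {j\<in>insert i K. w j < w y}"
        using finK by (intro card_mono) auto
      ultimately show ?thesis using pre[of y] y by simp
    qed
    ultimately show ?thesis unfolding slot_inv_def R' using X d K' tot cK by auto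
  next
    case False
    then have R': "R' B = (X, d - 1)" "d > 0" using kick unfolding kick_def R by (auto split: if_splits)
    have "card {s\<in>?O - X. w s < w y} + (\<mu> B - card ?O) \<le> card {j\<in>insert i K. w j < w y} + (d - 1)"
      if y: "y \<in> X" for y
      using pre[OF y] up[of y] False neq[OF y] y R'(2) by force
    then show ?thesis unfolding slot_inv_def R'(1) using X d K' tot cK R'(2) by auto
  qed
qed

lemma slot_inv_mono: "slot_inv S Y B st K \<Longrightarrow> Y \<subseteq> Y' \<Longrightarrow> slot_inv S Y' B st K"
  unfolding slot_inv_def by auto

text \<open>A free slot below \<open>i\<close> is an element of the sampled optimum that
  \<open>heads\<close> does not count; a free dummy means that this optimum has fewer than
  \<open>\<mu> B\<close> elements.\<close>

lemma heads_less_of_kick: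
  assumes S: "S \<subseteq> U" and B: "B \<in> F" and inv: "slot_inv S Y B (R B) K" and kick: "kick w R B i = Some R'"
  shows "heads S B i < \<mu> B"
proof -
  obtain X d where R: "R B = (X, d)" by (cases "R B")
  let ?O = "OPT F \<mu> w S B"
  have X: "X \<subseteq> ?O" and d: "d \<le> \<mu> B - card ?O" using inv unfolding slot_inv_def R by auto
  have finO: "finite ?O" using OPT_finite[of S B] S by auto
  show ?thesis
  proof (cases "\<exists>x\<in>X. w x < w i")
    case True
    then obtain x where "x \<in> ?O" "\<not> w i < w x" using X by force
    then have "{s\<in>?O. w i < w s} \<subset> ?O" by blast
    then have "heads S B i < card ?O"
      unfolding heads_def by (rule psubset_card_mono[OF finO])
    then show ?thesis using OPT_card[OF S B] by simp
  next
    case False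
    then have "d > 0" using kick unfolding kick_def R by (auto split: if_splits)
    moreover have "heads S B i \<le> card ?O" unfolding heads_def using finO by (intro card_mono) auto
    ultimately show ?thesis using d by simp
  qed
qed

lemma kick_None_iff: "kick w R B i = None \<longleftrightarrow> snd (R B) = 0 \<and> (\<forall>x\<in>fst (R B). \<not> w x < w i)"
  unfolding kick_def by (auto simp: split_beta)

lemma kick_other: "kick w R B i = Some R' \<Longrightarrow> A \<noteq> B \<Longrightarrow> R' A = R A"
  unfolding kick_def by (auto simp: split_beta split: if_splits)

text \<open>Candidacy at \<open>B\<close> needs \<open>heads < \<mu>\<close> in every block around
  \<open>i\<close> up to \<open>B\<close>. The chain is climbed from the bottom, so these are the
  blocks where \<open>i\<close> has already kicked; the hypothesis "still ahead, or inequality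
  known" records this. A kick changes \<open>R\<close> at its own block only, so a refusal can be
  stated for the initial \<open>R\<close>.\<close>

lemma process_chain_inv:
  assumes S: "S \<subseteq> U" and Y: "Y \<subseteq> U" "Y \<inter> S = {}" "i \<in> Y"
    and "sorted_wrt (\<subset>) Bs" "set Bs \<subseteq> {A\<in>F. i \<in> A}"
    and "\<And>A. A \<in> F \<Longrightarrow> i \<in> A \<Longrightarrow> A \<in> set Bs \<or> heads S A i < \<mu> A"
    and "\<And>B. B \<in> F \<Longrightarrow> slot_inv S Y B (R B) (SOL B)"
    and "\<And>B. B \<in> set Bs \<Longrightarrow> i \<notin> SOL B"
    and "process_chain w i Bs (R, SOL) = (R', SOL')"
  shows "\<forall>B\<in>F. slot_inv S Y B (R' B) (SOL' B)"
    and "(\<exists>B\<in>set Bs. kick w R B i = None) \<or> (\<forall>B\<in>set Bs. i \<in> SOL' B)"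
proof -
  have "(\<forall>B\<in>F. slot_inv S Y B (R' B) (SOL' B)) \<and>
    ((\<exists>B\<in>set Bs. kick w R B i = None) \<or> (\<forall>B\<in>set Bs. i \<in> SOL' B))"
    using assms(5-)
  proof (induction Bs arbitrary: R SOL)
    case Nil
    then show ?case by simp
  next
    case (Cons B Bs)
    have B: "B \<in> F" "i \<in> B" using Cons.prems(2) by auto
    show ?case
    proof (cases "kick w R B i")
      case None
      then show ?thesis using Cons.prems(4,6) by auto
    next
      case (Some R1)
      define SOL1 where "SOL1 = SOL(B := insert i (SOL B))"
      have B_notin: "B \<notin> set Bs" using Cons.prems(1) by auto
      have hB: "heads S B i < \<mu> B" using heads_less_of_kick[OF S B(1) Cons.prems(4)[OF B(1)] Some] .
      have hA: "heads S A i < \<mu> A" if "A \<in> F" "i \<in> A" "A \<notin> set Bs" for A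
        using Cons.prems(3)[OF that(1,2)] that(3) hB by auto
      have c: "cand S B i"
        unfolding cand_def using hA Cons.prems(1) by auto
      have inv1: "slot_inv S Y A (R1 A) (SOL1 A)" if "A \<in> F" for A
      proof (cases "A = B")
        case True
        then show ?thesis
          using slot_inv_kick[OF S Y B(2) _ c Cons.prems(4)[OF B(1)] Some] Cons.prems(5)[of B]
          unfolding SOL1_def by simp
      next
        case False
        then show ?thesis using Cons.prems(4)[OF that] kick_other[OF Some False] unfolding SOL1_def by simp
      qed
      have pc: "process_chain w i Bs (R1, SOL1) = (R', SOL')"
        using Cons.prems(6) Some unfolding SOL1_def by simp
      have IH: "(\<forall>B\<in>F. slot_inv S Y B (R' B) (SOL' B)) \<and>
         ((\<exists>B\<in>set Bs. kick w R1 B i = None) \<or> (\<forall>B\<in>set Bs. i \<in> SOL' B))"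
      proof (rule Cons.IH[OF _ _ _ inv1 _ pc])
        show "sorted_wrt (\<subset>) Bs" using Cons.prems(1) by simp
        show "set Bs \<subseteq> {A\<in>F. i \<in> A}" using Cons.prems(2) by auto
        show "A \<in> set Bs \<or> heads S A i < \<mu> A" if "A \<in> F" "i \<in> A" for A using hA that by blast
        show "i \<notin> SOL1 A" if "A \<in> set Bs" for A
          using Cons.prems(5)[of A] that B_notin unfolding SOL1_def by auto
      qed
      have "kick w R A i = None" if "A \<in> set Bs" "kick w R1 A i = None" for A
      proof -
        have "R1 A = R A" using kick_other[OF Some] B_notin that by metis
        then show ?thesis using that(2) unfolding kick_None_iff by simp
      qed
      moreover have "SOL1 B \<subseteq> SOL' B"
        using process_chain_mono[of "(R1, SOL1)" B w i Bs] pc by simp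
      then have "i \<in> SOL' B" unfolding SOL1_def by simp
      ultimately show ?thesis using IH by auto
    qed
  qed
  then show "\<forall>B\<in>F. slot_inv S Y B (R' B) (SOL' B)"
    and "(\<exists>B\<in>set Bs. kick w R B i = None) \<or> (\<forall>B\<in>set Bs. i \<in> SOL' B)" by auto
qed

abbreviation step :: "'a \<Rightarrow> ('a set \<Rightarrow> 'a set \<times> nat) \<times> ('a set \<Rightarrow> 'a set) \<Rightarrow> ('a set \<Rightarrow> 'a set \<times> nat) \<times> ('a set \<Rightarrow> 'a set)" where
  "step \<equiv> \<lambda>i. process_chain w i (chain_list F (minset F i) U)"

definition init :: "'a set \<Rightarrow> ('a set \<Rightarrow> 'a set \<times> nat) \<times> ('a set \<Rightarrow> 'a set)" where
  "init S = ((\<lambda>B. (OPT F \<mu> w S B, \<mu> B - card (OPT F \<mu> w S B))), (\<lambda>_. {}))"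

lemma kicknext_eq: "kicknext U F \<mu> w xs t = snd (fold step (drop t xs) (init (set (take t xs)))) U"
  unfolding kicknext_def init_def Let_def by simp

lemma SOL_subset: "snd (fold step ys (init S)) B \<subseteq> set ys"
proof (induction ys rule: rev_induct)
  case (snoc y ys)
  have "snd (step y (fold step ys (init S))) B \<subseteq> insert y (snd (fold step ys (init S)) B)"
    by (rule process_chain_subset)
  then show ?case using snoc by auto
qed (simp add: init_def)

lemma fold_step_inv:
  assumes S: "S \<subseteq> U" and "distinct ys" "set ys \<subseteq> U" "set ys \<inter> S = {}" and B: "B \<in> F"
  shows "slot_inv S (set ys) B (fst (fold step ys (init S)) B) (snd (fold step ys (init S)) B)"
  using assms(2-5)
proof (induction ys arbitrary: B rule: rev_induct)
  case Nil
  have "{s\<in>X - X. w s < w y} = {}" for X y by auto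
  then show ?case unfolding slot_inv_def init_def by (simp del: Diff_iff)
next
  case (snoc i ys)
  let ?Y = "set (ys @ [i])"
  obtain R SOL where st: "fold step ys (init S) = (R, SOL)" by fastforce
  have inv: "slot_inv S ?Y A (R A) (SOL A)" if "A \<in> F" for A
    using snoc.IH[of A] snoc.prems that st by (auto intro: slot_inv_mono)
  obtain R' SOL' where st': "step i (R, SOL) = (R', SOL')" by fastforce
  have i: "i \<in> U" "i \<notin> set ys" using snoc.prems by auto
  have notin: "i \<notin> SOL A" for A using SOL_subset[of ys S A] st i by auto
  have "\<forall>B\<in>F. slot_inv S ?Y B (R' B) (SOL' B)"
    using chain_list_props[OF i(1)] snoc.prems inv notin
    by (intro process_chain_inv(1)[OF S _ _ _ _ _ _ _ _ st']) auto
  then show ?case using st st' snoc.prems(4) by simp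
qed

text \<open>Let \<open>y\<close> be the lightest free slot and \<open>g\<close> the number of slots
  at or above it. All \<open>\<mu> B - g\<close> slots below \<open>y\<close>, dummies included, are
  used, so at least as many kickers lie below \<open>y\<close>, each with at least \<open>g\<close>
  heads above it. Hence \<open>m = \<mu> B - g\<close> works, or \<open>m = \<mu> B\<close> if no
  slot is free. The refusal puts \<open>x\<close> below \<open>y\<close>, so \<open>x\<close> too
  has \<open>g\<close> heads above it.\<close>

lemma tails_of_kick_None:
  assumes S: "S \<subseteq> U" and Y: "Y \<subseteq> U" "Y \<inter> S = {}" and x: "x \<in> U" "x \<notin> S" and B: "B \<in> F"
    and inv: "slot_inv S Y B (R B) K" and kick: "kick w R B x = None"
  shows "\<exists>m\<le>\<mu> B. \<mu> B \<le> heads S B x + m \<and> m \<le> card (tails S Y B m)"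
proof -
  obtain X d where R: "R B = (X, d)" by (cases "R B")
  let ?O = "OPT F \<mu> w S B"
  have no: "d = 0" "\<And>y. y \<in> X \<Longrightarrow> \<not> w y < w x" using kick unfolding kick_None_iff R by auto
  have X: "X \<subseteq> ?O" and K: "K \<subseteq> {j\<in>Y \<inter> B. cand S B j}"
    and tot: "card (?O - X) + (\<mu> B - card ?O) \<le> card K"
    and pre: "\<And>y. y \<in> X \<Longrightarrow> card {s\<in>?O - X. w s < w y} + (\<mu> B - card ?O) \<le> card {j\<in>K. w j < w y}"
    using inv no(1) unfolding slot_inv_def R by auto
  have SB: "S \<inter> B \<subseteq> U" using S by auto
  have finO: "finite ?O" using OPT_finite[OF SB] .
  have finY: "finite Y" using Y(1) finU finite_subset by blast
  have fin_tails: "finite (tails S Y B m)" for m unfolding tails_def using finY by simp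
  have cO: "card ?O \<le> \<mu> B" using OPT_card[OF S B] .
  show ?thesis
  proof (cases "X = {}")
    case True
    have "K \<subseteq> tails S Y B (\<mu> B)" using K unfolding tails_def by auto
    then have "card K \<le> card (tails S Y B (\<mu> B))" using fin_tails by (intro card_mono) auto
    then show ?thesis using tot True cO by (intro exI[of _ "\<mu> B"]) auto
  next
    case False
    have finX: "finite X" using X finO finite_subset by blast
    have "Min (w ` X) \<in> w ` X" using finX False by (intro Min_in) auto
    then obtain y where y: "y \<in> X" "w y = Min (w ` X)" by auto
    then have min: "w y \<le> w u" if "u \<in> X" for u using finX that by simp
    define g where "g = card {s\<in>?O. w y \<le> w s}"
    have split: "card {s\<in>?O. w s < w y} + g = card ?O"
    proof -
      have "?O = {s\<in>?O. w s < w y} \<union> {s\<in>?O. w y \<le> w s}" by auto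
      moreover have "card ({s\<in>?O. w s < w y} \<union> {s\<in>?O. w y \<le> w s}) = card {s\<in>?O. w s < w y} + g"
        unfolding g_def using finO by (intro card_Un_disjoint) auto
      ultimately show ?thesis by simp
    qed
    have "{s\<in>?O - X. w s < w y} = {s\<in>?O. w s < w y}" using min by fastforce
    then have m: "\<mu> B - g \<le> card {j\<in>K. w j < w y}" using pre[OF y(1)] split cO by simp
    have heads_ge: "g \<le> heads S B j" if "w j < w y" for j
      unfolding g_def heads_def using that finO by (intro card_mono) auto
    have "{j\<in>K. w j < w y} \<subseteq> tails S Y B (\<mu> B - g)"
      using K heads_ge unfolding tails_def by fastforce
    then have "card {j\<in>K. w j < w y} \<le> card (tails S Y B (\<mu> B - g))"
      using fin_tails by (intro card_mono) auto
    moreover have "w x < w y"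
    proof -
      have "y \<in> S" using y X OPT_subset[OF SB] by auto
      then have "w x \<noteq> w y" using x S inj_onD[OF w_inj, of x y] by auto
      then show ?thesis using no(2)[OF y(1)] by simp
    qed
    ultimately show ?thesis using m heads_ge[of x] by (intro exI[of _ "\<mu> B - g"]) auto
  qed
qed

lemma kicknext_failure:
  assumes xs: "xs \<in> permutations_of_set U" and split: "drop t xs = ys @ x # zs"
    and fail: "x \<notin> kicknext U F \<mu> w xs t"
  defines "S \<equiv> set (take t xs)"
  shows "\<exists>B\<in>F. x \<in> B \<and> (\<exists>m\<le>\<mu> B. \<mu> B \<le> heads S B x + m \<and> m \<le> card (tails S (set ys) B m))"
proof -
  have xs': "set xs = U" "distinct xs" using xs by (auto simp: permutations_of_set_def)
  have app: "xs = take t xs @ ys @ x # zs" using split by (metis append_take_drop_id)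
  have "distinct (take t xs @ ys @ x # zs)" "set (take t xs @ ys @ x # zs) = U"
    using xs' app by auto
  then have S: "S \<subseteq> U" "set ys \<subseteq> U" "set ys \<inter> S = {}" "distinct ys" "x \<in> U" "x \<notin> S" "x \<notin> set ys"
    unfolding S_def by auto
  obtain R SOL where st: "fold step ys (init S) = (R, SOL)" by fastforce
  obtain R' SOL' where st': "step x (R, SOL) = (R', SOL')" by fastforce
  have inv: "slot_inv S (set ys) B (R B) (SOL B)" if "B \<in> F" for B
    using fold_step_inv[OF S(1) S(4) S(2) S(3) that] st by simp
  have "kicknext U F \<mu> w xs t = snd (fold step zs (R', SOL')) U"
    unfolding kicknext_eq split S_def[symmetric] by (simp add: st st')
  then have "x \<notin> SOL' U" using fail
    fold_process_chain_mono[of "(R', SOL')" U w "\<lambda>i. chain_list F (minset F i) U" zs] by auto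
  \<comment> \<open>Processing \<open>x\<close> needs \<open>x\<close> among the arrivals; the final
    line returns to \<open>set ys\<close>, so \<open>x\<close> is not counted among its own
    obstacles.\<close>
  moreover have inv': "slot_inv S (insert x (set ys)) B (R B) (SOL B)" if "B \<in> F" for B
    using slot_inv_mono[OF inv[OF that]] by auto
  moreover have notin: "x \<notin> SOL A" for A using SOL_subset[of ys S A] st S by auto
  have "(\<exists>B\<in>set (chain_list F (minset F x) U). kick w R B x = None) \<or>
      (\<forall>B\<in>set (chain_list F (minset F x) U). x \<in> SOL' B)"
    using chain_list_props[OF S(5)] S inv' notin
    by (intro process_chain_inv(2)[OF S(1), of "insert x (set ys)", OF _ _ _ _ _ _ _ _ st']) auto
  ultimately obtain B where B: "B \<in> F" "x \<in> B" "kick w R B x = None"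
    using chain_list_props[OF S(5)] U_in S(5) by auto
  then show ?thesis using tails_of_kick_None[OF S(1) S(2) S(3) S(5) S(6) B(1) inv[OF B(1)] B(3)] by blast
qed

end

section \<open>Random labels\<close>

text \<open>The expectation of \<open>f\<close> when every element of \<open>V\<close> independently goes to the first
  argument, to the second argument, or to neither, with weights \<open>s\<close>, \<open>e\<close>, \<open>l\<close>.\<close>

definition label_sum :: "real \<Rightarrow> real \<Rightarrow> real \<Rightarrow> 'a set \<Rightarrow> ('a set \<Rightarrow> 'a set \<Rightarrow> real) \<Rightarrow> real" where
  "label_sum s e l V f =
     (\<Sum>A\<in>Pow V. \<Sum>E\<in>Pow (V - A). s ^ card A * e ^ card E * l ^ card (V - A - E) * f A E)"

lemma sum_Pow_insert:
  assumes "finite V" "j \<notin> V"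
  shows "(\<Sum>A\<in>Pow (insert j V). g A) = (\<Sum>A\<in>Pow V. g A + g (insert j A) :: real)"
proof -
  have inj: "inj_on (insert j) (Pow V)" using assms(2) by (auto simp: inj_on_def)
  have "(\<Sum>A\<in>Pow (insert j V). g A) = (\<Sum>A\<in>Pow V. g A) + (\<Sum>A\<in>insert j ` Pow V. g A)"
    unfolding Pow_insert using assms by (intro sum.union_disjoint) auto
  also have "(\<Sum>A\<in>insert j ` Pow V. g A) = (\<Sum>A\<in>Pow V. g (insert j A))"
    using inj by (simp add: sum.reindex)
  finally show ?thesis by (simp add: sum.distrib)
qed

lemma label_sum_empty: "label_sum s e l {} f = f {} {}"
  unfolding label_sum_def by simp

lemma label_sum_insert:
  assumes V: "finite V" "j \<notin> V"
  shows "label_sum s e l (insert j V) f =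
     label_sum s e l V (\<lambda>A E. s * f (insert j A) E + e * f A (insert j E) + l * f A E)"
proof -
  define t where "t = (\<lambda>V A E. s ^ card A * e ^ card E * l ^ card (V - A - E) * f A E)"
  have "(\<Sum>E\<in>Pow (insert j V - A). t (insert j V) A E) + (\<Sum>E\<in>Pow (insert j V - insert j A). t (insert j V) (insert j A) E)
     = (\<Sum>E\<in>Pow (V - A). s ^ card A * e ^ card E * l ^ card (V - A - E) *
          (s * f (insert j A) E + e * f A (insert j E) + l * f A E))"
    if A: "A \<in> Pow V" for A
  proof -
    have fin: "finite A" "finite (V - A)" and nj: "j \<notin> A" "j \<notin> V - A"
      using A V finite_subset by auto
    have eq: "insert j V - A = insert j (V - A)" "insert j V - insert j A = V - A" using nj V by auto
    have tt: "t (insert j V) A E = l * (s ^ card A * e ^ card E * l ^ card (V - A - E)) * f A E"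
      "t (insert j V) A (insert j E) = e * (s ^ card A * e ^ card E * l ^ card (V - A - E)) * f A (insert j E)"
      "t (insert j V) (insert j A) E = s * (s ^ card A * e ^ card E * l ^ card (V - A - E)) * f (insert j A) E"
      if E: "E \<in> Pow (V - A)" for E
    proof -
      have finE: "finite E" "j \<notin> E" using E fin finite_subset nj by auto
      have "insert j V - A - E = insert j (V - A - E)" "insert j V - A - insert j E = V - A - E"
        "insert j V - insert j A - E = V - A - E"
        using finE nj V by auto
      moreover have "card (insert j (V - A - E)) = Suc (card (V - A - E))"
        "card (insert j E) = Suc (card E)" "card (insert j A) = Suc (card A)"
        using finE nj fin by auto
      ultimately show "t (insert j V) A E = l * (s ^ card A * e ^ card E * l ^ card (V - A - E)) * f A E"
        "t (insert j V) A (insert j E) = e * (s ^ card A * e ^ card E * l ^ card (V - A - E)) * f A (insert j E)"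
        "t (insert j V) (insert j A) E = s * (s ^ card A * e ^ card E * l ^ card (V - A - E)) * f (insert j A) E"
        unfolding t_def by auto
    qed
    have "(\<Sum>E\<in>Pow (insert j V - A). t (insert j V) A E) =
        (\<Sum>E\<in>Pow (V - A). t (insert j V) A E + t (insert j V) A (insert j E))"
      unfolding eq by (rule sum_Pow_insert[OF fin(2) nj(2)])
    then show ?thesis
      unfolding eq using tt by (simp add: sum.distrib[symmetric] algebra_simps)
  qed
  then show ?thesis
    unfolding label_sum_def sum_Pow_insert[OF V] t_def by (intro sum.cong) auto
qed

lemma label_sum_mono:
  assumes "0 \<le> s" "0 \<le> e" "0 \<le> l" "\<And>A E. A \<subseteq> V \<Longrightarrow> E \<subseteq> V - A \<Longrightarrow> f A E \<le> g A E"
  shows "label_sum s e l V f \<le> label_sum s e l V g"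
  unfolding label_sum_def using assms by (intro sum_mono mult_left_mono) auto

lemma label_sum_one:
  assumes "finite V" "s + e + l = 1"
  shows "label_sum s e l V (\<lambda>_ _. 1) = 1"
  using assms(1)
proof (induction V rule: finite_induct)
  case (insert j V)
  then show ?case using assms(2) by (simp add: label_sum_insert)
qed (simp add: label_sum_empty)

lemma label_sum_diff: "label_sum s e l V (\<lambda>A E. f A E - g A E) = label_sum s e l V f - label_sum s e l V g"
  unfolding label_sum_def by (simp add: right_diff_distrib sum_subtractf)

lemma label_sum_sum: "label_sum s e l V (\<lambda>A E. \<Sum>i\<in>I. f i A E) = (\<Sum>i\<in>I. label_sum s e l V (f i))"
proof -
  have "label_sum s e l V (\<lambda>A E. \<Sum>i\<in>I. f i A E) =
     (\<Sum>A\<in>Pow V. \<Sum>i\<in>I. \<Sum>E\<in>Pow (V - A). s ^ card A * e ^ card E * l ^ card (V - A - E) * f i A E)"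
    unfolding label_sum_def sum_distrib_left by (intro sum.cong refl sum.swap)
  also have "\<dots> = (\<Sum>i\<in>I. label_sum s e l V (f i))"
    unfolding label_sum_def by (rule sum.swap)
  finally show ?thesis .
qed

text \<open>A supermartingale for \<open>h\<close> heads and \<open>t\<close> counted tails, when tails have
  probability \<open>q\<close>, are counted from head \<open>k - m\<close> on, and the tosses end with head \<open>k\<close>.
  Dividing by \<open>2 * (1 - q)\<close> is possible because at least one head is missing when tail \<open>m\<close>
  is counted.\<close>

definition pot :: "real \<Rightarrow> nat \<Rightarrow> nat \<Rightarrow> nat \<Rightarrow> nat \<Rightarrow> real" where
  "pot q m k h t = (if m \<le> t then 1 else (2 * (1 - q)) ^ min (k - h) m * (2 * q) ^ (m - t) / (2 * (1 - q)))"

lemma pot_nonneg: "0 \<le> q \<Longrightarrow> q \<le> 1/2 \<Longrightarrow> 0 \<le> pot q m k h t"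
  unfolding pot_def by auto

lemma pot_antimono:
  assumes "0 \<le> q" "q \<le> 1/2" "h \<le> h'"
  shows "pot q m k h' t \<le> pot q m k h t"
  unfolding pot_def using assms
  by (auto intro!: divide_right_mono mult_right_mono power_increasing)

text \<open>With weight \<open>l\<close> nothing changes. Among tosses, while tails are counted, a
  head divides the potential by 2 * (1 - q) and a tail by at least 2 * q (for q > 0), and (1 - q) /
  (2 * (1 - q)) + q / (2 * q) = 1. Before the counting window neither outcome changes it.\<close>

lemma pot_step:
  assumes q: "0 \<le> q" "q \<le> 1/2" and l: "0 \<le> l" "l \<le> 1" and h: "h < k"
  shows "(1 - l) * (1 - q) * pot q m k (Suc h) t
      + (1 - l) * q * pot q m k h (if k \<le> h + m then Suc t else t) + l * pot q m k h t \<le> pot q m k h t"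
proof -
  have le: "(1 - q) * pot q m k (Suc h) t + q * pot q m k h (if k \<le> h + m then Suc t else t) \<le> pot q m k h t"
  proof -
    consider "m \<le> t" | "\<not> m \<le> t" "h + m < k" | "\<not> m \<le> t" "k \<le> h + m" by linarith
    then show ?thesis
    proof cases
      case 1
      then show ?thesis unfolding pot_def by simp
    next
      case 2
      then have "min (k - Suc h) m = m" "min (k - h) m = m" by auto
      then have "pot q m k (Suc h) t = pot q m k h t" unfolding pot_def by simp
      then show ?thesis using 2 by (simp add: algebra_simps)
    next
      case 3
      define i where "i = k - Suc h"
      define n where "n = m - Suc t"
      have mins: "min (k - Suc h) m = i" "min (k - h) m = Suc i" "m - t = Suc n"
        using 3 h unfolding i_def n_def by auto
      have "pot q m k h (Suc t) \<le> (2 * (1 - q)) ^ Suc i * (2 * q) ^ n / (2 * (1 - q))"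
      proof (cases "m \<le> Suc t")
        case True
        have "n = 0" using True unfolding n_def by simp
        moreover have "1 \<le> (2 * (1 - q)) ^ i" using q by (intro one_le_power) auto
        ultimately show ?thesis using True q unfolding pot_def by simp
      next
        case False
        then show ?thesis unfolding pot_def mins n_def by simp
      qed
      then have "q * pot q m k h (Suc t) \<le> q * ((2 * (1 - q)) ^ Suc i * (2 * q) ^ n / (2 * (1 - q)))"
        using q by (intro mult_left_mono) auto
      moreover have "(1 - q) * ((2 * (1 - q)) ^ i * (2 * q) ^ Suc n / (2 * (1 - q)))
          + q * ((2 * (1 - q)) ^ Suc i * (2 * q) ^ n / (2 * (1 - q)))
          = (2 * (1 - q)) ^ Suc i * (2 * q) ^ Suc n / (2 * (1 - q))"
      proof -
        \<comment> \<open>Only \<open>a\<close> is cancelled; keeping 2 * q as a factor covers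
          \<open>q = 0\<close>.\<close>
        have gen: "(a / 2) * (x * (2 * q * y) / a) + q * (a * x * y / a) = a * x * (2 * q * y) / a"
          if "a \<noteq> 0" for a x y :: real
          using that by (simp add: field_simps)
        have half: "2 * (1 - q) / 2 = 1 - q" "2 * (1 - q) \<noteq> 0" using q by auto
        show ?thesis
          using gen[OF half(2), of "(2 * (1 - q)) ^ i" "(2 * q) ^ n"] unfolding half(1) power_Suc .
      qed
      moreover have "pot q m k (Suc h) t = (2 * (1 - q)) ^ i * (2 * q) ^ Suc n / (2 * (1 - q))"
        "pot q m k h t = (2 * (1 - q)) ^ Suc i * (2 * q) ^ Suc n / (2 * (1 - q))"
        using 3(1) unfolding pot_def mins by simp_all
      ultimately show ?thesis using 3(2) by (simp only: if_True)
    qed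
  qed
  have "(1 - l) * ((1 - q) * pot q m k (Suc h) t + q * pot q m k h (if k \<le> h + m then Suc t else t))
     \<le> (1 - l) * pot q m k h t" using le l by (intro mult_left_mono) auto
  then show ?thesis by (simp add: algebra_simps)
qed

section \<open>Candidates as coin tosses\<close>

context laminar_instance
begin

lemma cand_insert_lighter:
  assumes "insert j S \<subseteq> U" "w j < w i"
  shows "cand (insert j S) B i \<longleftrightarrow> cand S B i"
  unfolding cand_def using heads_insert_lighter[OF assms] by simp

lemma tails_insert_lighter:
  assumes "insert j S \<subseteq> U" "\<And>i. i \<in> E \<Longrightarrow> w j < w i"
  shows "tails (insert j S) E B m = tails S E B m"
  unfolding tails_def using heads_insert_lighter[OF assms(1)] cand_insert_lighter[OF assms(1)] assms(2) by auto

text \<open>The lightest \<open>j\<close> of \<open>V\<close> is revealed last, when the heads and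
  candidates among the others are decided. If \<open>j\<close> is a candidate of \<open>B\<close>, a
  head enlarges the optimum by one and a tail is counted exactly if
  \<open>\<mu> B \<le> h + m\<close>, as in \<open>pot_step\<close>. If not, a tail is never
  counted, and a head cannot raise the potential.\<close>

lemma label_sum_pot_le:
  assumes q: "0 \<le> q" "q \<le> 1/2" and l: "0 \<le> l" "l \<le> 1" and B: "B \<in> F" and V: "V \<subseteq> U"
  shows "label_sum ((1 - l) * (1 - q)) ((1 - l) * q) l V
      (\<lambda>A E. pot q m (\<mu> B) (card (OPT F \<mu> w A B)) (card (tails A E B m))) \<le> pot q m (\<mu> B) 0 0"
  using V
proof (induction "card V" arbitrary: V)
  case 0
  then have "V = {}" using finU by (metis card_eq_0_iff finite_subset)
  moreover have "OPT F \<mu> w {} B = {}" "tails {} {} B m = {}"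
    using OPT_subset[of "{}" B] unfolding tails_def by auto
  ultimately show ?case by (simp add: label_sum_empty)
next
  case (Suc n)
  have finV: "finite V" "V \<noteq> {}" using Suc finU finite_subset by auto
  have "Min (w ` V) \<in> w ` V" using finV by (intro Min_in) auto
  then obtain j where j: "j \<in> V" "w j = Min (w ` V)" by auto
  define W where "W = V - {j}"
  have W: "V = insert j W" "j \<notin> W" "finite W" "n = card W" "W \<subseteq> U" "j \<in> U"
    using j finV Suc.hyps(2) Suc.prems unfolding W_def by auto
  have light: "w j < w i" if "i \<in> W" for i
  proof -
    have "i \<noteq> j" "i \<in> V" using that W by auto
    moreover have "w j \<noteq> w i"
      using inj_onD[OF w_inj, of j i] calculation j(1) Suc.prems by auto
    moreover have "w j \<le> w i" using calculation(2) j(2) finV(1) by simp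
    ultimately show ?thesis by simp
  qed
  let ?s = "(1 - l) * (1 - q)" and ?e = "(1 - l) * q"
  let ?p = "\<lambda>A E. pot q m (\<mu> B) (card (OPT F \<mu> w A B)) (card (tails A E B m))"
  have s: "0 \<le> ?s" "0 \<le> ?e" using q l by auto
  have "label_sum ?s ?e l V ?p = label_sum ?s ?e l W
      (\<lambda>A E. ?s * ?p (insert j A) E + ?e * ?p A (insert j E) + l * ?p A E)"
    unfolding W(1) by (rule label_sum_insert[OF W(3,2)])
  also have "\<dots> \<le> label_sum ?s ?e l W ?p"
  proof (rule label_sum_mono[OF s l(1)])
    fix A E assume A: "A \<subseteq> W" and E: "E \<subseteq> W - A"
    have AU: "A \<subseteq> U" "insert j A \<subseteq> U" using A W by auto
    have lA: "w j < w s" if "s \<in> A" for s using light A that by auto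
    have lE: "w j < w i" if "i \<in> E" for i using light E that by auto
    have tS: "tails (insert j A) E B m = tails A E B m" using tails_insert_lighter[OF AU(2) lE] by simp
    have hj: "heads A B j = card (OPT F \<mu> w A B)" using heads_lightest[OF AU(1) lA] by simp
    have finE: "finite E" "j \<notin> E" using E W finite_subset[of E W] by auto
    let ?h = "card (OPT F \<mu> w A B)" and ?t = "card (tails A E B m)"
    have fint: "finite (tails A E B m)" "j \<notin> tails A E B m" using finE unfolding tails_def by auto
    show "?s * ?p (insert j A) E + ?e * ?p A (insert j E) + l * ?p A E \<le> ?p A E"
    proof (cases "j \<in> B \<and> cand A B j")
      case True
      then have "OPT F \<mu> w (insert j A) B = insert j (OPT F \<mu> w A B)"
        using OPT_insert_cand[OF AU(2) lA B] by auto
      moreover have "j \<notin> OPT F \<mu> w A B" using OPT_subset[of A B] AU A W by auto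
      moreover have "finite (OPT F \<mu> w A B)" using OPT_finite[of A B] AU by auto
      ultimately have "card (OPT F \<mu> w (insert j A) B) = Suc ?h" by simp
      moreover have "tails A (insert j E) B m = (if \<mu> B \<le> ?h + m then insert j (tails A E B m) else tails A E B m)"
        using True hj unfolding tails_def by auto
      then have "card (tails A (insert j E) B m) = (if \<mu> B \<le> ?h + m then Suc ?t else ?t)"
        using fint by simp
      moreover have "?h < \<mu> B" using True B hj unfolding cand_def by auto
      ultimately show ?thesis using pot_step[OF q l, of ?h "\<mu> B" m ?t] tS by simp
    next
      case False
      then have tE: "tails A (insert j E) B m = tails A E B m" unfolding tails_def by auto
      have "?p (insert j A) E \<le> ?p A E"
        unfolding tS using OPT_insert_lightest_mono[OF AU(2) lA] by (intro pot_antimono q) auto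
      then have "?s * ?p (insert j A) E \<le> ?s * ?p A E" using s by (intro mult_left_mono) auto
      moreover have "?s * ?p A E + ?e * ?p A E + l * ?p A E = ?p A E" by (simp add: algebra_simps)
      ultimately show ?thesis unfolding tE by simp
    qed
  qed
  also have "\<dots> \<le> pot q m (\<mu> B) 0 0" using Suc.hyps(1)[OF W(4,5)] .
  finally show ?case .
qed

text \<open>Markov's inequality for \<open>pot\<close>, which is 1 once \<open>m\<close> tails are
  counted. Initially \<open>m \<le> \<mu> B\<close> makes the exponent \<open>m\<close>, with value
  (4 * q * (1 - q)) ^ m / (2 * (1 - q)).\<close>

lemma label_sum_tails_le:
  assumes q: "0 \<le> q" "q \<le> 1/2" and l: "0 \<le> l" "l \<le> 1" and B: "B \<in> F" and V: "V \<subseteq> U"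
    and m: "0 < m" "m \<le> \<mu> B"
  shows "label_sum ((1 - l) * (1 - q)) ((1 - l) * q) l V
      (\<lambda>A E. of_bool (m \<le> card (tails A E B m))) \<le> 2 * q * (4 * q * (1 - q)) ^ (m - 1)"
proof -
  have "label_sum ((1 - l) * (1 - q)) ((1 - l) * q) l V (\<lambda>A E. of_bool (m \<le> card (tails A E B m)))
     \<le> label_sum ((1 - l) * (1 - q)) ((1 - l) * q) l V
      (\<lambda>A E. pot q m (\<mu> B) (card (OPT F \<mu> w A B)) (card (tails A E B m)))"
  proof (rule label_sum_mono)
    fix A E
    show "of_bool (m \<le> card (tails A E B m)) \<le> pot q m (\<mu> B) (card (OPT F \<mu> w A B)) (card (tails A E B m))"
      using pot_nonneg[OF q, of m "\<mu> B" "card (OPT F \<mu> w A B)" "card (tails A E B m)"]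
      by (cases "m \<le> card (tails A E B m)") (simp_all add: pot_def[of _ _ _ _ "card (tails A E B m)"] del: power_mult_distrib)
  qed (use q l in auto)
  also have "\<dots> \<le> pot q m (\<mu> B) 0 0" by (rule label_sum_pot_le[OF q l B V])
  also have "\<dots> = (2 * (1 - q)) ^ m * (2 * q) ^ m / (2 * (1 - q))" unfolding pot_def using m by simp
  also have "\<dots> = 2 * q * (4 * q * (1 - q)) ^ (m - 1)"
  proof -
    obtain n where n: "m = Suc n" using m gr0_implies_Suc by blast
    have "4 * q * (1 - q) = (2 * (1 - q)) * (2 * q)" by simp
    moreover have "a ^ Suc n * b ^ Suc n / a = b * (a * b) ^ n" if "a \<noteq> 0" for a b :: real
      using that by (simp add: power_mult_distrib)
    moreover have "2 * (1 - q) \<noteq> 0" using q by simp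
    ultimately show ?thesis unfolding n diff_Suc_1 by (simp only:)
  qed
  finally show ?thesis .
qed

end

section \<open>The arrival order\<close>

lemma has_integral_Beta_nat:
  "((\<lambda>\<tau>::real. \<tau> ^ a * (1 - \<tau>) ^ b) has_integral fact a * fact b / fact (a + b + 1)) {0..1}"
proof -
  have "((\<lambda>t. t powr ((1 + real a) - 1) * (1 - t) powr ((1 + real b) - 1)) has_integral
      Beta (1 + real a) (1 + real b)) {0..1}"
    by (intro has_integral_Beta_real) auto
  moreover have "Beta (1 + real a) (1 + real b) = fact a * fact b / fact (a + b + 1)"
  proof -
    have "(1 + real a) + (1 + real b) = 1 + real (a + b + 1)" by simp
    then show ?thesis unfolding Beta_def by (metis Gamma_fact)
  qed
  ultimately have *: "((\<lambda>t. t powr ((1 + real a) - 1) * (1 - t) powr ((1 + real b) - 1)) has_integral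
      fact a * fact b / fact (a + b + 1)) {0..1}" by simp
  \<comment> \<open>\<open>0 powr 0\<close> is 0 while \<open>0 ^ 0\<close> is 1, so the integrands
    may differ at the endpoints.\<close>
  show ?thesis
    by (rule has_integral_spike_finite[OF _ _ *, of "{0, 1}"]) (auto simp: powr_realpow)
qed

definition arrival_set :: "'a list \<Rightarrow> nat \<Rightarrow> 'a \<Rightarrow> 'a set" where
  "arrival_set xs t x = set (takeWhile (\<lambda>y. y \<noteq> x) (drop t xs))"

text \<open>\<open>t\<close> is forced to be \<open>card A\<close>, and only the orders within the
  three segments are free; the fibers are therefore counted by products of three factorials.\<close>

lemma permutation_fiber:
  assumes U: "finite U" "x \<in> U" and A: "A \<subseteq> U - {x}" and E: "E \<subseteq> U - {x} - A"
  defines "L \<equiv> U - {x} - A - E"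
  shows "{z \<in> permutations_of_set U \<times> {..card U}. case z of (xs, t) \<Rightarrow>
            x \<in> set (drop t xs) \<and> set (take t xs) = A \<and> arrival_set xs t x = E}
       = (\<lambda>(a, e, l). (a @ e @ x # l, card A)) `
           (permutations_of_set A \<times> permutations_of_set E \<times> permutations_of_set L)"
    (is "?Z = ?h ` ?P")
proof (intro equalityI subsetI)
  fix z assume "z \<in> ?Z"
  then obtain xs t where z: "z = (xs, t)" "xs \<in> permutations_of_set U" "t \<le> card U"
    "x \<in> set (drop t xs)" "set (take t xs) = A" "arrival_set xs t x = E" by auto
  define a where "a = take t xs"
  define e where "e = takeWhile (\<lambda>y. y \<noteq> x) (drop t xs)"
  define l where "l = tl (dropWhile (\<lambda>y. y \<noteq> x) (drop t xs))"
  have ne: "dropWhile (\<lambda>y. y \<noteq> x) (drop t xs) \<noteq> []" using z(4) by (simp add: dropWhile_eq_Nil_conv)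
  have "hd (dropWhile (\<lambda>y. y \<noteq> x) (drop t xs)) = x" using hd_dropWhile[OF ne] by simp
  then have "dropWhile (\<lambda>y. y \<noteq> x) (drop t xs) = x # l" using ne unfolding l_def by (metis list.collapse)
  then have "drop t xs = e @ x # l" unfolding e_def by (metis takeWhile_dropWhile_id)
  then have xs: "xs = a @ e @ x # l" unfolding a_def by (metis append_take_drop_id)
  have d: "distinct (a @ e @ x # l)" "set (a @ e @ x # l) = U"
    using z(2) xs by (auto simp: permutations_of_set_def)
  have sets: "set a = A" "set e = E" using z(5,6) unfolding a_def e_def arrival_set_def by auto
  have "set l = L" using d sets unfolding L_def by auto
  then have "(a, e, l) \<in> ?P" using d sets by (auto simp: permutations_of_set_def)
  moreover have "length a = t"
  proof -
    have "length xs = card U" using z(2) length_finite_permutations_of_set by blast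
    then show ?thesis using z(3) unfolding a_def by simp
  qed
  then have "card A = t" using d sets distinct_card[of a] by simp
  ultimately show "z \<in> ?h ` ?P" using xs z(1) by (intro image_eqI[of _ _ "(a, e, l)"]) auto
next
  fix z assume "z \<in> ?h ` ?P"
  then obtain a e l where z: "z = (a @ e @ x # l, card A)" and
    p: "set a = A" "distinct a" "set e = E" "distinct e" "set l = L" "distinct l"
    by (auto simp: permutations_of_set_def)
  have la: "length a = card A" using p distinct_card[of a] by simp
  have "distinct (a @ e @ x # l)" "set (a @ e @ x # l) = U" using p A E U unfolding L_def by auto
  then have "a @ e @ x # l \<in> permutations_of_set U" by (auto simp: permutations_of_set_def)
  moreover have "card A \<le> card U" using A U(1) by (intro card_mono) auto
  moreover have "arrival_set (a @ e @ x # l) (card A) x = E"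
  proof -
    have "takeWhile (\<lambda>y. y \<noteq> x) (e @ x # l) = e"
      using E p(3) by (subst takeWhile_append2) auto
    then show ?thesis unfolding arrival_set_def using la p(3) by simp
  qed
  ultimately show "z \<in> ?Z" unfolding z using la p(1) by simp
qed

lemma card_permutation_fiber:
  assumes U: "finite U" "x \<in> U" and A: "A \<subseteq> U - {x}" and E: "E \<subseteq> U - {x} - A"
  shows "card {z \<in> permutations_of_set U \<times> {..card U}. case z of (xs, t) \<Rightarrow>
            x \<in> set (drop t xs) \<and> set (take t xs) = A \<and> arrival_set xs t x = E}
       = fact (card A) * fact (card E) * fact (card (U - {x} - A - E))"
proof -
  have fin: "finite A" "finite E" "finite (U - {x} - A - E)"
    using U(1) A E finite_subset[of A U] finite_subset[of E U] by auto
  have "inj_on (\<lambda>(a, e, l). (a @ e @ x # l, card A))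
      (permutations_of_set A \<times> permutations_of_set E \<times> permutations_of_set (U - {x} - A - E))"
    by (auto simp: inj_on_def dest!: length_finite_permutations_of_set)
  then show ?thesis
    unfolding permutation_fiber[OF assms] using fin
    by (simp add: card_image card_cartesian_product)
qed

text \<open>Conditioning on the arrival time \<open>\<tau>\<close> of \<open>x\<close> within \<open>T\<close>, the other
  elements are independently sampled, early or late.\<close>

lemma arrival_integral:
  fixes p :: real and U :: "'a set"
  assumes U: "finite U" "x \<in> U" and p: "0 \<le> p" "p \<le> 1"
  defines "M \<equiv> pair_pmf (pmf_of_set (permutations_of_set U)) (binomial_pmf (card U) (1 - p))"
  shows "((\<lambda>\<tau>. p * label_sum (1 - p) (p * \<tau>) (p * (1 - \<tau>)) (U - {x}) f) has_integral
      measure_pmf.expectation M (\<lambda>(xs, t). if x \<in> set (drop t xs)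
        then f (set (take t xs)) (arrival_set xs t x) else 0)) {0..1}"
proof -
  define n where "n = card U"
  define V where "V = U - {x}"
  define Q where "Q = {z \<in> permutations_of_set U \<times> {..n}. case z of (xs, t) \<Rightarrow> x \<in> set (drop t xs)}"
  define g where "g = (\<lambda>z. case z of (xs, t) \<Rightarrow> (set (take t xs), arrival_set xs t x))"
  define I where "I = (SIGMA A:Pow V. Pow (V - A))"
  define b where "b = (\<lambda>k. real (n choose k) * (1 - p) ^ k * p ^ (n - k) / fact n)"
  define \<phi> where "\<phi> = (\<lambda>(xs, t). if x \<in> set (drop t xs) then f (set (take t xs)) (arrival_set xs t x) else 0)"
  have fin: "finite (permutations_of_set U \<times> {..n})" "finite Q" "finite I" "finite V"
    unfolding Q_def I_def V_def using U(1) by auto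
  have pmfM: "pmf M (xs, t) = b t" if "xs \<in> permutations_of_set U" for xs t
    unfolding M_def b_def n_def pmf_pair using U(1) p that by (simp add: pmf_of_set card_permutations_of_set)
  have setM: "set_pmf M \<subseteq> permutations_of_set U \<times> {..n}"
    unfolding M_def n_def using U(1) p by (auto simp: set_pmf_binomial_eq split: if_splits)
  have "measure_pmf.expectation M \<phi> = (\<Sum>z\<in>permutations_of_set U \<times> {..n}. \<phi> z * pmf M z)"
    using setM fin by (intro integral_measure_pmf_real) auto
  also have "\<dots> = (\<Sum>z\<in>Q. \<phi> z * pmf M z)"
    unfolding Q_def \<phi>_def using fin by (intro sum.mono_neutral_right) (auto split: if_splits)
  also have "\<dots> = (\<Sum>z\<in>Q. (case g z of (A, E) \<Rightarrow> f A E * b (card A)))"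
  proof (rule sum.cong[OF refl])
    fix z assume "z \<in> Q"
    then obtain xs t where z: "z = (xs, t)" "xs \<in> permutations_of_set U" "t \<le> n" "x \<in> set (drop t xs)"
      unfolding Q_def by auto
    have "length xs = n" "distinct (take t xs)"
      using z(2) length_finite_permutations_of_set unfolding n_def by (auto simp: permutations_of_set_def)
    then have "card (set (take t xs)) = t" using z(3) by (simp add: distinct_card)
    then show "\<phi> z * pmf M z = (case g z of (A, E) \<Rightarrow> f A E * b (card A))"
      unfolding \<phi>_def g_def using z pmfM by simp
  qed
  also have "\<dots> = (\<Sum>y\<in>I. \<Sum>z\<in>{z\<in>Q. g z = y}. (case g z of (A, E) \<Rightarrow> f A E * b (card A)))"
  proof (rule sum.group[symmetric, OF fin(2,3)])
    show "g ` Q \<subseteq> I"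
    proof (rule image_subsetI)
      fix z assume "z \<in> Q"
      then obtain xs t where z: "z = (xs, t)" "xs \<in> permutations_of_set U" "x \<in> set (drop t xs)"
        unfolding Q_def by auto
      have "distinct (take t xs @ drop t xs)" "set (take t xs @ drop t xs) = U"
        unfolding append_take_drop_id using z(2) by (auto simp: permutations_of_set_def)
      then have d: "set (take t xs) \<inter> set (drop t xs) = {}" "set (take t xs) \<subseteq> U" "set (drop t xs) \<subseteq> U"
        unfolding distinct_append set_append by blast+
      have "arrival_set xs t x \<subseteq> set (drop t xs) - {x}"
        unfolding arrival_set_def by (auto dest: set_takeWhileD)
      then show "g z \<in> I" unfolding g_def I_def V_def z(1) using d z(3) by auto
    qed
  qed
  also have "\<dots> = (\<Sum>(A, E)\<in>I. f A E * (b (card A) * (fact (card A) * fact (card E) * fact (card (V - A - E)))))"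
  proof (rule sum.cong[OF refl], clarify)
    fix A E assume "(A, E) \<in> I"
    then have AE: "A \<subseteq> U - {x}" "E \<subseteq> U - {x} - A" unfolding I_def V_def by auto
    have "{z\<in>Q. g z = (A, E)} = {z \<in> permutations_of_set U \<times> {..card U}. case z of (xs, t) \<Rightarrow>
            x \<in> set (drop t xs) \<and> set (take t xs) = A \<and> arrival_set xs t x = E}"
      unfolding Q_def g_def n_def by auto
    then have "card {z\<in>Q. g z = (A, E)} = fact (card A) * fact (card E) * fact (card (V - A - E))"
      unfolding V_def using card_permutation_fiber[OF U AE] by simp
    moreover have "(\<Sum>z\<in>{z\<in>Q. g z = (A, E)}. (case g z of (A, E) \<Rightarrow> f A E * b (card A)))
        = (\<Sum>z\<in>{z\<in>Q. g z = (A, E)}. f A E * b (card A))"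
      by (intro sum.cong) auto
    ultimately show "(\<Sum>z\<in>{z\<in>Q. g z = (A, E)}. (case g z of (A, E) \<Rightarrow> f A E * b (card A)))
       = f A E * (b (card A) * (fact (card A) * fact (card E) * fact (card (V - A - E))))"
      by simp
  qed
  also have "\<dots> = (\<Sum>A\<in>Pow V. \<Sum>E\<in>Pow (V - A).
      f A E * (b (card A) * (fact (card A) * fact (card E) * fact (card (V - A - E)))))"
    unfolding I_def using fin(4) by (subst sum.Sigma) (auto intro: finite_subset)
  finally have Ex: "measure_pmf.expectation M \<phi> = \<dots>" .
  have "((\<lambda>\<tau>. \<Sum>A\<in>Pow V. \<Sum>E\<in>Pow (V - A).
      p * ((1 - p) ^ card A * (p * \<tau>) ^ card E * (p * (1 - \<tau>)) ^ card (V - A - E) * f A E)) has_integral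
      (\<Sum>A\<in>Pow V. \<Sum>E\<in>Pow (V - A).
        f A E * (b (card A) * (fact (card A) * fact (card E) * fact (card (V - A - E)))))) {0..1}"
  proof (intro has_integral_sum)
    show "finite (Pow V)" using fin(4) by simp
    fix A assume A: "A \<in> Pow V"
    show "finite (Pow (V - A))" using fin(4) by simp
    fix E assume E: "E \<in> Pow (V - A)"
    define a e l where ael: "a = card A" "e = card E" "l = card (V - A - E)"
    have finAE: "finite A" "finite E" using A E fin(4) by (auto intro: finite_subset)
    have "card V = a + e + l"
      using A E fin(4) finAE card_Diff_subset[of A V] card_Diff_subset[of E "V - A"]
        card_mono[of V A] card_mono[of "V - A" E] unfolding ael by auto
    moreover have "n = Suc (card V)" unfolding n_def V_def using card_Suc_Diff1[OF U] by simp
    ultimately have n: "n = a + (e + l + 1)" by simp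
    have bin: "real (n choose a) = fact n / (fact a * fact (e + l + 1))"
      using binomial_fact[of a n, where 'a = real] n by simp
    have na: "n - a = Suc (e + l)" using n by simp
    \<comment> \<open>\<open>n - a\<close> exceeds \<open>e + l\<close> by one because
      \<open>x\<close> itself is in T, whence the leading \<open>p\<close>. The quotient of
      factorials is the Beta integral of \<tau> ^ e * (1 - \<tau>) ^ l.\<close>
    have coef: "b a * (fact a * fact e * fact l) = p * (1 - p) ^ a * p ^ e * p ^ l * (fact e * fact l / fact (e + l + 1))"
    proof -
      have gen: "N / (G * D) * P * (p * (x * y)) / N * (G * u * v) = p * P * x * y * (u * v / D)"
        if "N \<noteq> 0" "G \<noteq> 0" for N G D P x y u v :: real
        using that by simp
      show ?thesis
        unfolding b_def bin na power_Suc power_add by (rule gen) simp_all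
    qed
    have "((\<lambda>\<tau>. (f A E * (p * (1 - p) ^ a * p ^ e * p ^ l)) * (\<tau> ^ e * (1 - \<tau>) ^ l)) has_integral
       (f A E * (p * (1 - p) ^ a * p ^ e * p ^ l)) * (fact e * fact l / fact (e + l + 1))) {0..1}"
      by (intro has_integral_mult_right has_integral_Beta_nat)
    moreover have "(\<lambda>\<tau>. (f A E * (p * (1 - p) ^ a * p ^ e * p ^ l)) * (\<tau> ^ e * (1 - \<tau>) ^ l))
       = (\<lambda>\<tau>. p * ((1 - p) ^ a * (p * \<tau>) ^ e * (p * (1 - \<tau>)) ^ l * f A E))"
      by (simp add: power_mult_distrib mult_ac)
    ultimately show "((\<lambda>\<tau>. p * ((1 - p) ^ card A * (p * \<tau>) ^ card E * (p * (1 - \<tau>)) ^ card (V - A - E) * f A E))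
       has_integral f A E * (b (card A) * (fact (card A) * fact (card E) * fact (card (V - A - E))))) {0..1}"
      unfolding ael[symmetric] coef by (simp only: mult.assoc)
  qed
  then show ?thesis
    unfolding Ex[unfolded \<phi>_def] label_sum_def V_def by (simp add: sum_distrib_left)
qed

section \<open>The competitive ratio\<close>

text \<open>The mean of q over the arrival time, equal to \<open>\<alpha> * c / 2\<close>. The
  antiderivative comes from writing the integrand as 1 - (1 - p) / (1 - p + p * \<tau>).\<close>

lemma has_integral_early_ratio:
  fixes p :: real
  assumes "0 < p" "p < 1"
  shows "((\<lambda>\<tau>. p * \<tau> / (1 - p + p * \<tau>)) has_integral (p + (1 - p) * ln (1 - p)) / p) {0..1}"
proof -
  define G where "G = (\<lambda>\<tau>. \<tau> - (1 - p) / p * ln (1 - p + p * \<tau>))"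
  have "((\<lambda>\<tau>. p * \<tau> / (1 - p + p * \<tau>)) has_integral G 1 - G 0) {0..1}"
  proof (rule fundamental_theorem_of_calculus)
    fix \<tau> :: real assume "\<tau> \<in> {0..1}"
    then have pos: "0 < 1 - p + p * \<tau>" using assms by (simp add: add_pos_nonneg)
    have "(G has_real_derivative 1 - (1 - p) / p * (p / (1 - p + p * \<tau>))) (at \<tau> within {0..1})"
      unfolding G_def using pos by (auto intro!: derivative_eq_intros)
    moreover have "1 - (1 - p) / p * (p / (1 - p + p * \<tau>)) = p * \<tau> / (1 - p + p * \<tau>)"
    proof -
      have "(1 - p) / p * (p / (1 - p + p * \<tau>)) = (1 - p) / (1 - p + p * \<tau>)" using assms(1) by simp
      then show ?thesis using pos by (simp add: field_simps)
    qed
    ultimately show "(G has_vector_derivative p * \<tau> / (1 - p + p * \<tau>)) (at \<tau> within {0..1})"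
      by (simp add: has_real_derivative_iff_has_vector_derivative)
  qed simp
  moreover have "G 1 - G 0 = (p + (1 - p) * ln (1 - p)) / p"
    unfolding G_def using assms by (simp add: field_simps)
  ultimately show ?thesis by simp
qed

lemma sum_power_tail_le:
  fixes c :: real
  assumes c: "0 \<le> c" "c < 1" and a: "0 < a" "a \<le> k"
  shows "(\<Sum>m=a..k. c ^ (m - 1)) \<le> c ^ (a - 1) / (1 - c)"
proof -
  have "(\<Sum>m=a..k. c ^ (m - 1)) = (\<Sum>i=a-1..k-1. c ^ i)"
    using a by (intro sum.reindex_bij_witness[of _ Suc "\<lambda>m. m - 1"]) auto
  also have "\<dots> = (c ^ (a - 1) - c ^ Suc (k - 1)) / (1 - c)"
    using a c by (subst sum_gp) auto
  also have "\<dots> \<le> c ^ (a - 1) / (1 - c)" using c by (intro divide_right_mono) auto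
  finally show ?thesis .
qed

section \<open>Union bound over the blocks around one element\<close>

context laminar_instance
begin

lemma kicknext_subset: "xs \<in> permutations_of_set U \<Longrightarrow> kicknext U F \<mu> w xs t \<subseteq> U"
  unfolding kicknext_eq using SOL_subset[of "drop t xs"] set_drop_subset[of t xs]
  by (fastforce simp: permutations_of_set_def)

definition rank_above :: "'a set \<Rightarrow> 'a \<Rightarrow> nat" where
  "rank_above B x = card {y\<in>OPT F \<mu> w U U \<inter> B. w x < w y}"

text \<open>Counts the bad pairs \<open>(B, m)\<close> for a union bound, as a function of the
  sample and the early arrivals only, the form that \<open>arrival_integral\<close> accepts.\<close>

definition failure_bound :: "'a \<Rightarrow> 'a set \<Rightarrow> 'a set \<Rightarrow> real" where
  "failure_bound x S E = (\<Sum>B | B \<in> F \<and> x \<in> B. \<Sum>m=\<mu> B - rank_above B x..\<mu> B.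
      of_bool (m \<le> card (tails S E B m)))"

lemma rank_above_less:
  assumes "x \<in> OPT F \<mu> w U U" "x \<in> B" "B \<in> F"
  shows "rank_above B x < \<mu> B"
proof -
  have "rank_above B x < card (OPT F \<mu> w U U \<inter> B)"
    unfolding rank_above_def using OPT_finite[of U U] assms by (intro psubset_card_mono) auto
  then show ?thesis using indepD[OF OPT_indep[of U U] assms(3)] by simp
qed

text \<open>A rejected \<open>x\<close> has a bad pair, and \<open>heads\<close> being at most
  \<open>rank_above\<close> puts it in the summation range. A negative left side does no harm in a
  lower bound.\<close>

lemma kicknext_success_ge:
  assumes xs: "xs \<in> permutations_of_set U" and x: "x \<in> OPT F \<mu> w U U"
  shows "(if x \<in> set (drop t xs) then 1 - failure_bound x (set (take t xs)) (arrival_set xs t x) else 0)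
     \<le> of_bool (x \<in> kicknext U F \<mu> w xs t)"
proof -
  let ?S = "set (take t xs)" and ?E = "arrival_set xs t x"
  have nonneg: "0 \<le> failure_bound x ?S ?E" unfolding failure_bound_def by (intro sum_nonneg) auto
  have "1 \<le> failure_bound x ?S ?E" if drop: "x \<in> set (drop t xs)" and fail: "x \<notin> kicknext U F \<mu> w xs t"
  proof -
    obtain ys zs where split: "drop t xs = ys @ x # zs" "x \<notin> set ys"
      using split_list_first[OF drop] by blast
    have "takeWhile (\<lambda>y. y \<noteq> x) (ys @ x # zs) = ys"
      using split(2) by (subst takeWhile_append2) auto
    then have E: "?E = set ys" unfolding arrival_set_def split(1) by simp
    have S: "?S \<subseteq> U" using xs set_take_subset[of t xs] by (auto simp: permutations_of_set_def)
    obtain B m where B: "B \<in> F" "x \<in> B" "m \<le> \<mu> B" "\<mu> B \<le> heads ?S B x + m" "m \<le> card (tails ?S ?E B m)"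
      using kicknext_failure[OF xs split(1) fail] unfolding E by blast
    have "heads ?S B x \<le> rank_above B x"
      unfolding rank_above_def by (rule heads_le_OPT_heavier[OF S B(1) x B(2)])
    then have m: "m \<in> {\<mu> B - rank_above B x..\<mu> B}" using B(3,4) by auto
    have "1 = (of_bool (m \<le> card (tails ?S ?E B m)) :: real)" using B(5) by simp
    also have "\<dots> \<le> (\<Sum>m=\<mu> B - rank_above B x..\<mu> B. of_bool (m \<le> card (tails ?S ?E B m)))"
      using m by (intro member_le_sum) auto
    also have "\<dots> \<le> failure_bound x ?S ?E"
      unfolding failure_bound_def using B(1,2) finF
      by (intro member_le_sum[of B "{B. B \<in> F \<and> x \<in> B}"]) (auto intro: sum_nonneg)
    finally show ?thesis .
  qed
  then show ?thesis using nonneg by auto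
qed

text \<open>The labels split into a late test of weight \<open>l\<close> and a toss with tail
  probability \<open>q\<close>. The base is bounded by \<open>c\<close>, but the leading
  \<open>q\<close> is kept, because averaging it over \<tau> is sharper than bounding it by
  \<open>p\<close>.\<close>

lemma label_sum_failure_ge:
  fixes p \<tau> :: real
  assumes p: "0 < p" "p < 1/2" and \<tau>: "\<tau> \<in> {0..1}" and x: "x \<in> OPT F \<mu> w U U"
  defines "c \<equiv> 4 * p * (1 - p)"
  shows "1 - p * \<tau> / (1 - p + p * \<tau>) * (2 * (\<Sum>B | B \<in> F \<and> x \<in> B. c ^ (\<mu> B - rank_above B x - 1)) / (1 - c))
     \<le> label_sum (1 - p) (p * \<tau>) (p * (1 - \<tau>)) (U - {x}) (\<lambda>S E. 1 - failure_bound x S E)"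
proof -
  define q where "q = p * \<tau> / (1 - p + p * \<tau>)"
  define l where "l = p * (1 - \<tau>)"
  have l: "0 \<le> l" "l \<le> 1" unfolding l_def using p \<tau> mult_mono[of p 1 "1 - \<tau>" 1] by auto
  have pos: "0 < 1 - p + p * \<tau>" using p \<tau> by (simp add: add_pos_nonneg)
  have l1: "1 - l = 1 - p + p * \<tau>" unfolding l_def by (simp add: algebra_simps)
  have e: "(1 - l) * q = p * \<tau>" unfolding l1 q_def using pos by simp
  have "(1 - l) * (1 - q) = 1 - l - p * \<tau>" by (simp only: right_diff_distrib mult_1_right e)
  then have s: "(1 - l) * (1 - q) = 1 - p" using l1 by linarith
  have "p * \<tau> \<le> p * (1 - p + p * \<tau>)"
  proof -
    have "p * (1 - p + p * \<tau>) - p * \<tau> = p * ((1 - p) * (1 - \<tau>))" by (simp add: algebra_simps)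
    also have "\<dots> \<ge> 0" using p \<tau> by simp
    finally show ?thesis by simp
  qed
  then have qp: "q \<le> p" unfolding q_def using pos by (simp add: divide_le_eq)
  have q: "0 \<le> q" "q \<le> 1/2"
  proof -
    show "0 \<le> q" unfolding q_def using p \<tau> pos by simp
    show "q \<le> 1/2" using qp p by simp
  qed
  have c: "0 < c" "c < 1"
  proof -
    show "0 < c" unfolding c_def using p by simp
    have "0 < (1 - 2 * p)\<^sup>2" using p by simp
    then show "c < 1" unfolding c_def by (simp add: power2_eq_square algebra_simps)
  qed
  have qc: "0 \<le> 4 * q * (1 - q)" "4 * q * (1 - q) \<le> c"
  proof -
    show "0 \<le> 4 * q * (1 - q)" using q by simp
    \<comment> \<open>Monotonicity of 4 * q * (1 - q) as a factorisation; both factors are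
      nonnegative since \<open>q \<le> p < 1/2\<close>.\<close>
    have "c - 4 * q * (1 - q) = 4 * ((p - q) * (1 - p - q))" unfolding c_def by (simp add: algebra_simps)
    also have "\<dots> \<ge> 0" using qp p q by simp
    finally show "4 * q * (1 - q) \<le> c" by simp
  qed
  let ?L = "label_sum (1 - p) (p * \<tau>) (p * (1 - \<tau>)) (U - {x})"
  let ?H = "{B. B \<in> F \<and> x \<in> B}"
  have "?L (failure_bound x) = (\<Sum>B\<in>?H. \<Sum>m=\<mu> B - rank_above B x..\<mu> B. ?L (\<lambda>S E. of_bool (m \<le> card (tails S E B m))))"
    unfolding failure_bound_def label_sum_sum ..
  also have "\<dots> \<le> (\<Sum>B\<in>?H. 2 * q * (c ^ (\<mu> B - rank_above B x - 1) / (1 - c)))"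
  proof (rule sum_mono)
    fix B assume B: "B \<in> ?H"
    have r: "rank_above B x < \<mu> B" using rank_above_less x B by auto
    have "(\<Sum>m=\<mu> B - rank_above B x..\<mu> B. ?L (\<lambda>S E. of_bool (m \<le> card (tails S E B m))))
        \<le> (\<Sum>m=\<mu> B - rank_above B x..\<mu> B. 2 * q * c ^ (m - 1))"
    proof (rule sum_mono)
      fix m assume m: "m \<in> {\<mu> B - rank_above B x..\<mu> B}"
      have "?L (\<lambda>S E. of_bool (m \<le> card (tails S E B m))) \<le> 2 * q * (4 * q * (1 - q)) ^ (m - 1)"
      proof -
        have "B \<in> F" "0 < m" "m \<le> \<mu> B" using B m r by auto
        then show ?thesis
          using label_sum_tails_le[OF q l \<open>B \<in> F\<close> Diff_subset[of U "{x}"], of m]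
          unfolding s e unfolding l_def by blast
      qed
      also have "\<dots> \<le> 2 * q * c ^ (m - 1)" using q qc by (intro mult_left_mono power_mono) auto
      finally show "?L (\<lambda>S E. of_bool (m \<le> card (tails S E B m))) \<le> 2 * q * c ^ (m - 1)" .
    qed
    also have "\<dots> = 2 * q * (\<Sum>m=\<mu> B - rank_above B x..\<mu> B. c ^ (m - 1))" by (simp add: sum_distrib_left)
    also have "\<dots> \<le> 2 * q * (c ^ (\<mu> B - rank_above B x - 1) / (1 - c))"
      using q c r by (intro mult_left_mono sum_power_tail_le) auto
    finally show "(\<Sum>m=\<mu> B - rank_above B x..\<mu> B. ?L (\<lambda>S E. of_bool (m \<le> card (tails S E B m))))
      \<le> 2 * q * (c ^ (\<mu> B - rank_above B x - 1) / (1 - c))" .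
  qed
  also have "\<dots> = q * (2 * (\<Sum>B\<in>?H. c ^ (\<mu> B - rank_above B x - 1)) / (1 - c))"
    by (simp add: sum_distrib_left sum_divide_distrib mult_ac)
  finally have "?L (failure_bound x) \<le> q * (2 * (\<Sum>B\<in>?H. c ^ (\<mu> B - rank_above B x - 1)) / (1 - c))" .
  moreover have "?L (\<lambda>S E. 1 - failure_bound x S E) = ?L (\<lambda>_ _. 1) - ?L (failure_bound x)"
    by (rule label_sum_diff)
  moreover have "?L (\<lambda>_ _. 1) = 1"
    using finU by (intro label_sum_one) (auto simp: algebra_simps)
  ultimately show ?thesis unfolding q_def by simp
qed

text \<open>Only \<open>q\<close> in the pointwise bound depends on \<tau>, so integration replaces
  it by its mean. The factor \<open>p\<close> is the probability that \<open>x\<close> falls in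
  T.\<close>

lemma kicknext_success_probability:
  fixes p :: real
  assumes p: "0 < p" "p < 1/2" and x: "x \<in> OPT F \<mu> w U U"
  defines "c \<equiv> 4 * p * (1 - p)"
    and "M \<equiv> pair_pmf (pmf_of_set (permutations_of_set U)) (binomial_pmf (card U) (1 - p))"
  shows "p * (1 - 2 * ((p + (1 - p) * ln (1 - p)) / p) / (1 - c) *
            (\<Sum>B | B \<in> F \<and> x \<in> B. c ^ (\<mu> B - rank_above B x - 1)))
       \<le> measure_pmf.expectation M (\<lambda>(xs, t). of_bool (x \<in> kicknext U F \<mu> w xs t))"
proof -
  define D where "D = 2 * (\<Sum>B | B \<in> F \<and> x \<in> B. c ^ (\<mu> B - rank_above B x - 1)) / (1 - c)"
  define Z where "Z = measure_pmf.expectation M (\<lambda>(xs, t). if x \<in> set (drop t xs)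
        then 1 - failure_bound x (set (take t xs)) (arrival_set xs t x) else 0)"
  have xU: "x \<in> U" using x OPT_subset[of U U] by auto
  have int1: "((\<lambda>\<tau>. p * label_sum (1 - p) (p * \<tau>) (p * (1 - \<tau>)) (U - {x}) (\<lambda>S E. 1 - failure_bound x S E))
      has_integral Z) {0..1}"
    unfolding Z_def M_def using p by (intro arrival_integral finU xU) auto
  have "((\<lambda>\<tau>. p * (1 - p * \<tau> / (1 - p + p * \<tau>) * D)) has_integral
      p * (1 - (p + (1 - p) * ln (1 - p)) / p * D)) {0..1}"
    using has_integral_const_real[of "1::real" 0 1] p
    by (intro has_integral_mult_right has_integral_diff has_integral_mult_left has_integral_early_ratio) auto
  then have "p * (1 - (p + (1 - p) * ln (1 - p)) / p * D) \<le> Z"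
  proof (rule has_integral_le[OF _ int1])
    fix \<tau> :: real assume "\<tau> \<in> {0..1}"
    then show "p * (1 - p * \<tau> / (1 - p + p * \<tau>) * D)
       \<le> p * label_sum (1 - p) (p * \<tau>) (p * (1 - \<tau>)) (U - {x}) (\<lambda>S E. 1 - failure_bound x S E)"
      unfolding D_def c_def using p x by (intro mult_left_mono label_sum_failure_ge) auto
  qed
  also have "Z \<le> measure_pmf.expectation M (\<lambda>(xs, t). of_bool (x \<in> kicknext U F \<mu> w xs t))"
  proof -
    have set: "set_pmf M \<subseteq> permutations_of_set U \<times> {..card U}"
      unfolding M_def using finU p by (auto simp: set_pmf_binomial_eq split: if_splits)
    then have "finite (set_pmf M)" by (rule finite_subset) simp
    then show ?thesis
      unfolding Z_def
    proof (intro integral_mono_AE integrable_measure_pmf_finite)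
      show "AE z in measure_pmf M. (case z of (xs, t) \<Rightarrow> if x \<in> set (drop t xs)
          then 1 - failure_bound x (set (take t xs)) (arrival_set xs t x) else 0)
        \<le> (case z of (xs, t) \<Rightarrow> of_bool (x \<in> kicknext U F \<mu> w xs t))"
        unfolding AE_measure_pmf_iff using set kicknext_success_ge[OF _ x] by auto
    qed
  qed
  also have "(p + (1 - p) * ln (1 - p)) / p * D = 2 * ((p + (1 - p) * ln (1 - p)) / p) / (1 - c) *
      (\<Sum>B | B \<in> F \<and> x \<in> B. c ^ (\<mu> B - rank_above B x - 1))"
    unfolding D_def by simp
  finally show ?thesis .
qed

end

theorem theorem1:
  fixes U :: "'a set" and F :: "'a set set" and \<mu> :: "'a set \<Rightarrow> nat"
    and w :: "'a \<Rightarrow> real" and p \<alpha> c :: real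
  assumes finU: "finite U"
    and w_nonneg: "\<forall>x\<in>U. w x \<ge> 0"
    and w_distinct: "inj_on w U"
    and lam: "laminar F"
    and F_sub: "\<forall>A\<in>F. A \<subseteq> U"
    and U_in: "U \<in> F"
    and mu_pos: "\<forall>A\<in>F. \<mu> A > 0"
    and mu_mono: "\<forall>A\<in>F. \<forall>B\<in>F. A \<subset> B \<longrightarrow> \<mu> A < \<mu> B"
    and p_pos: "0 < p" and p_half: "p < 1/2"
    and alpha_def: "\<alpha> = (p + (1 - p) * ln (1 - p)) / (2 * (1 - p) * p^2)"
    and c_def: "c = 4 * p * (1 - p)"
    and c_half: "c < 1/2"
  shows "measure_pmf.expectation
           (pair_pmf (pmf_of_set (permutations_of_set U)) (binomial_pmf (card U) (1 - p)))
           (\<lambda>(xs, t). wsum w (kicknext U F \<mu> w xs t))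
         \<ge> p * (1 - 2 * \<alpha> * c / (1 - c)^2) * wsum w (OPT F \<mu> w U U)"
proof -
  interpret laminar_instance U F \<mu> w
    using assms by unfold_locales auto
  define M where "M = pair_pmf (pmf_of_set (permutations_of_set U)) (binomial_pmf (card U) (1 - p))"
  define X where "X = OPT F \<mu> w U U"
  define J where "J = (p + (1 - p) * ln (1 - p)) / p"
  define d where "d = (\<lambda>x. \<Sum>B | B \<in> F \<and> x \<in> B. c ^ (\<mu> B - rank_above B x - 1))"
  define K where "K = (\<lambda>(xs, t). kicknext U F \<mu> w xs t)"
  have X: "X \<subseteq> U" "finite X" "indep F \<mu> X"
    unfolding X_def using OPT_subset[of U U] OPT_finite[of U U] OPT_indep[of U U] by auto
  have c: "0 < c" "c < 1" unfolding c_def using p_pos p_half c_half c_def by auto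
  have J: "\<alpha> * c = 2 * J"
  proof -
    have "\<alpha> * c = (p + (1 - p) * ln (1 - p)) / (2 * (1 - p) * p^2) * (4 * p * (1 - p))"
      unfolding alpha_def c_def ..
    also have "\<dots> = 2 * J" unfolding J_def using p_pos p_half by (simp add: field_simps power2_eq_square)
    finally show ?thesis .
  qed
  \<comment> \<open>The charging bound enters with a minus sign, so the sign of \<open>J\<close>
    matters; the integral gives it without an estimate of the logarithm.\<close>
  have "0 \<le> J"
  proof (rule has_integral_nonneg)
    show "((\<lambda>\<tau>. p * \<tau> / (1 - p + p * \<tau>)) has_integral J) {0..1}"
      unfolding J_def using p_pos p_half by (intro has_integral_early_ratio) auto
    show "0 \<le> p * \<tau> / (1 - p + p * \<tau>)" if "\<tau> \<in> {0..1}" for \<tau>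
      using that p_pos p_half by (intro divide_nonneg_nonneg add_nonneg_nonneg mult_nonneg_nonneg) auto
  qed
  have set: "set_pmf M \<subseteq> permutations_of_set U \<times> {..card U}"
    unfolding M_def using finU p_pos p_half by (auto simp: set_pmf_binomial_eq split: if_splits)
  then have fin: "finite (set_pmf M)" by (rule finite_subset) simp
  note integrable = integrable_measure_pmf_finite[OF fin]
  have charge: "(\<Sum>x\<in>X. w x * d x) \<le> 2 / (1 - c) * wsum w X"
    unfolding d_def rank_above_def X_def[symmetric] wsum_def
    using X w_nonneg by (intro laminar_weighted_charging c finF lam mu_mono inj_on_subset[OF w_distinct]) auto
  \<comment> \<open>The constant splits into \<open>2 * J / (1 - c)\<close>, the failure of one
    element, and \<open>2 / (1 - c)\<close>, the charging.\<close>
  have "p * (1 - 2 * \<alpha> * c / (1 - c)^2) * wsum w X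
      = p * (wsum w X - 2 * J / (1 - c) * (2 / (1 - c) * wsum w X))"
  proof -
    have "2 * \<alpha> * c = 2 * (2 * J)" using J by simp
    then show ?thesis using c by (simp add: field_simps power2_eq_square)
  qed
  also have "\<dots> \<le> p * (wsum w X - 2 * J / (1 - c) * (\<Sum>x\<in>X. w x * d x))"
    using charge p_pos \<open>0 \<le> J\<close> c by (intro mult_left_mono diff_left_mono) auto
  also have "\<dots> = (\<Sum>x\<in>X. w x * (p * (1 - 2 * J / (1 - c) * d x)))"
  proof -
    have "p * (wsum w X - k * (\<Sum>x\<in>X. w x * d x)) = (\<Sum>x\<in>X. w x * (p * (1 - k * d x)))" for k
      unfolding wsum_def by (simp add: algebra_simps sum_subtractf sum_distrib_left)
    then show ?thesis .
  qed
  also have "\<dots> \<le> (\<Sum>x\<in>X. w x * measure_pmf.expectation M (\<lambda>z. of_bool (x \<in> K z)))"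
  proof (intro sum_mono mult_left_mono)
    fix x assume x: "x \<in> X"
    show "p * (1 - 2 * J / (1 - c) * d x) \<le> measure_pmf.expectation M (\<lambda>z. of_bool (x \<in> K z))"
      using kicknext_success_probability[OF p_pos p_half x[unfolded X_def]]
      unfolding J_def d_def M_def K_def c_def by (simp add: case_prod_unfold)
    show "0 \<le> w x" using x X w_nonneg by auto
  qed
  also have "\<dots> = measure_pmf.expectation M (\<lambda>z. \<Sum>x\<in>X. w x * of_bool (x \<in> K z))"
    by (subst Bochner_Integration.integral_sum[OF integrable]) simp
  \<comment> \<open>Selected elements outside \<open>OPT\<close> are dropped; their weights are
    nonnegative because the output lies in \<open>U\<close>.\<close>
  also have "\<dots> \<le> measure_pmf.expectation M (\<lambda>z. wsum w (K z))"
  proof (intro integral_mono_AE integrable)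
    show "AE z in measure_pmf M. (\<Sum>x\<in>X. w x * of_bool (x \<in> K z)) \<le> wsum w (K z)"
      unfolding AE_measure_pmf_iff
    proof
      fix z assume "z \<in> set_pmf M"
      then have sub: "K z \<subseteq> U" using set kicknext_subset unfolding K_def by (auto split: prod.splits)
      have "(\<Sum>x\<in>X. w x * of_bool (x \<in> K z)) = (\<Sum>x\<in>X \<inter> K z. w x)"
        using X(2) by (simp add: sum.inter_restrict of_bool_def if_distrib cong: if_cong)
      also have "\<dots> \<le> (\<Sum>x\<in>K z. w x)"
        using sub finU w_nonneg by (intro sum_mono2) (auto intro: finite_subset)
      finally show "(\<Sum>x\<in>X. w x * of_bool (x \<in> K z)) \<le> wsum w (K z)" unfolding wsum_def .
    qed
  qed
  finally show ?thesis unfolding X_def M_def K_def by (simp add: case_prod_unfold)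
qed

end
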